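(* For every state $\rho$ on $\mathbb{C}^d$, $C_d(\rho)=0$ implies $C_c(\rho)=0$. Equivalently, every state $\rho$ that is not diagonal in the incoherent basis (i.e. has a non-zero off-diagonal entry) satisfies $C_d(\rho)>0$.
   Context: Fix an orthonormal (incoherent) basis $\{\ket{i}\}_{i=1}^d$ of $\mathbb{C}^d$; on tensor products the incoherent basis is the product basis. An incoherent operation is a CPTP map $T(\rho)=\sum_\ell K_\ell\rho K_\ell^\dagger$ having a Kraus representation with each $K_\ell=\sum_i c_\ell(i)\ket{j_\ell(i)}\!\bra{i}$ for some function $j_\ell$ of basis indices. $\Phi_2=\ket{\Phi_2}\!\bra{\Phi_2}$, $\ket{\Phi_2}=\frac1{\sqrt2}(\ket0+\ket1)$; $F(\rho,\sigma)=\operatorname{tr}\sqrt{\rho^{1/2}\sigma\rho^{1/2}}$. Distillable coherence $C_d(\rho)$: supremum of $R\ge0$ such that there are incoherent operations $T_n$ with $F(T_n(\rho^{\otimes n}),\Phi_2^{\otimes\lfloor nR\rfloor})\to1$ as $n\to\infty$. Coherence cost $C_c(\rho)$: infimum of $R\ge0$ such that there are incoherent operations $T_n$ with $F(T_n(\Phi_2^{\otimes\lceil nR\rceil}),\rho^{\otimes n})\to1$ as $n\to\infty$. *)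

theory Defs
  imports "HOL-Analysis.Analysis" "Jordan_Normal_Form.Matrix"
begin

definition adj :: "complex mat \<Rightarrow> complex mat" where
  "adj A = mat (dim_col A) (dim_row A) (\<lambda>(i,j). cnj (A $$ (j,i)))"

definition tr :: "complex mat \<Rightarrow> complex" where
  "tr A = (\<Sum>i<dim_row A. A $$ (i,i))"

definition psd :: "nat \<Rightarrow> complex mat \<Rightarrow> bool" where
  "psd n A \<longleftrightarrow> A \<in> carrier_mat n n \<and> adj A = A \<and>
     (\<forall>v \<in> carrier_vec n. 0 \<le> Re (conjugate v \<bullet> (A *\<^sub>v v)))"

definition is_state :: "nat \<Rightarrow> complex mat \<Rightarrow> bool" where
  "is_state d \<rho> \<longleftrightarrow> psd d \<rho> \<and> tr \<rho> = 1"

text \<open>Kronecker (tensor) product; the standard basis of the result is the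
  product of the standard (incoherent) bases, in lexicographic order.\<close>
definition kron :: "complex mat \<Rightarrow> complex mat \<Rightarrow> complex mat" where
  "kron A B = mat (dim_row A * dim_row B) (dim_col A * dim_col B)
     (\<lambda>(i,j). A $$ (i div dim_row B, j div dim_col B) * B $$ (i mod dim_row B, j mod dim_col B))"

fun tpow :: "nat \<Rightarrow> complex mat \<Rightarrow> complex mat" where
  "tpow 0 A = 1\<^sub>m 1"
| "tpow (Suc n) A = kron A (tpow n A)"

definition msqrt :: "complex mat \<Rightarrow> complex mat" where
  "msqrt A = (THE B. psd (dim_row A) B \<and> B * B = A)"

definition fidelity :: "complex mat \<Rightarrow> complex mat \<Rightarrow> complex" where
  "fidelity \<rho> \<sigma> = tr (msqrt (msqrt \<rho> * \<sigma> * msqrt \<rho>))"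

text \<open>The maximally coherent qubit state Phi_2 = |Phi_2><Phi_2|, |Phi_2> = (|0>+|1>)/sqrt 2.\<close>
definition Phi2 :: "complex mat" where
  "Phi2 = mat 2 2 (\<lambda>_. 1/2)"

text \<open>A Kraus operator C^d1 -> C^d2 of incoherent form
  K = sum_i c(i) |j(i)><i|: each column has at most one nonzero entry.\<close>
definition incoherent_kraus_op :: "nat \<Rightarrow> nat \<Rightarrow> complex mat \<Rightarrow> bool" where
  "incoherent_kraus_op d1 d2 K \<longleftrightarrow> K \<in> carrier_mat d2 d1 \<and>
     (\<forall>i<d1. \<exists>j<d2. \<forall>k<d2. k \<noteq> j \<longrightarrow> K $$ (k,i) = 0)"

definition incoherent_op :: "nat \<Rightarrow> nat \<Rightarrow> complex mat list \<Rightarrow> bool" where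
  "incoherent_op d1 d2 Ks \<longleftrightarrow> (\<forall>K \<in> set Ks. incoherent_kraus_op d1 d2 K) \<and>
     foldr (\<lambda>K acc. adj K * K + acc) Ks (0\<^sub>m d1 d1) = 1\<^sub>m d1"

definition apply_op :: "nat \<Rightarrow> complex mat list \<Rightarrow> complex mat \<Rightarrow> complex mat" where
  "apply_op d2 Ks \<rho> = foldr (\<lambda>K acc. K * \<rho> * adj K + acc) Ks (0\<^sub>m d2 d2)"

definition distill_achievable :: "nat \<Rightarrow> complex mat \<Rightarrow> real \<Rightarrow> bool" where
  "distill_achievable d \<rho> R \<longleftrightarrow> R \<ge> 0 \<and>
     (\<exists>T :: nat \<Rightarrow> complex mat list.
        (\<forall>n. incoherent_op (d ^ n) (2 ^ nat \<lfloor>real n * R\<rfloor>) (T n)) \<and>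
        (\<lambda>n. fidelity (apply_op (2 ^ nat \<lfloor>real n * R\<rfloor>) (T n) (tpow n \<rho>))
                       (tpow (nat \<lfloor>real n * R\<rfloor>) Phi2)) \<longlonglongrightarrow> 1)"

definition cost_achievable :: "nat \<Rightarrow> complex mat \<Rightarrow> real \<Rightarrow> bool" where
  "cost_achievable d \<rho> R \<longleftrightarrow> R \<ge> 0 \<and>
     (\<exists>T :: nat \<Rightarrow> complex mat list.
        (\<forall>n. incoherent_op (2 ^ nat \<lceil>real n * R\<rceil>) (d ^ n) (T n)) \<and>
        (\<lambda>n. fidelity (apply_op (d ^ n) (T n) (tpow (nat \<lceil>real n * R\<rceil>) Phi2))
                       (tpow n \<rho>)) \<longlonglongrightarrow> 1)"

text \<open>Supremum / infimum taken in the extended reals (so they are always defined).\<close>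
definition distillable_coherence :: "nat \<Rightarrow> complex mat \<Rightarrow> ereal" where
  "distillable_coherence d \<rho> = Sup (ereal ` {R. distill_achievable d \<rho> R})"

definition coherence_cost :: "nat \<Rightarrow> complex mat \<Rightarrow> ereal" where
  "coherence_cost d \<rho> = Inf (ereal ` {R. cost_achievable d \<rho> R})"

end

theory Submission
  imports Defs "Jordan_Normal_Form.Jordan_Normal_Form_Existence"
begin

text \<open>If \<open>\<rho>\<close> is diagonal, the incoherent Kraus operators \<open>sqrt (p i) |i><0|\<close> prepare it exactly
  from a trivial system, so its cost is 0.

  If \<open>\<rho>\<close> has an entry of modulus \<open>a > 0\<close> off the diagonal, one copy is mapped incoherently to
  the dephased qubit with off-diagonal entries \<open>a\<close>, that is, to \<open>Phi2\<close> with a phase flip of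
  probability \<open>1/2 - a\<close>. On \<open>n\<close> such qubits the phase error is a random bit string \<open>e\<close>, with the
  characters of \<open>{0,1}^n\<close> as corresponding orthonormal states. Given a linear code \<open>W\<close> of size
  \<open>2^k\<close>, measuring the coset \<open>e + W\<close> in the character basis and correcting the most likely error
  of that coset is an incoherent operation with output on \<open>k\<close> qubits. By the Bhattacharyya bound it fails with
  probability at most the sum of \<open>sqrt (p e * p (e + w))\<close> over all \<open>e\<close> and all nonzero \<open>w \<in> W\<close>;
  over all \<open>w\<close> this sum is \<open>c^n\<close> with \<open>c = 1 + sqrt (1 - 4a^2) < 2\<close>, so a greedy choice of \<open>W\<close>
  makes it at most \<open>2 * 2^k * (c/2)^n\<close>, which tends to 0 for some positive rate \<open>k/n\<close>.\<close>

no_notation Inner_Product.real_inner_class.inner (infix "\<bullet>" 70)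

section \<open>Positive semidefinite matrices and fidelity\<close>

text \<open>Only the positivity of the rate matters, so \<open>\<rho>\<close> may be degraded to a
  state whose tensor powers have entries depending on \<open>xor x y\<close> alone. Such matrices
  are diagonal in the characters, and distillation becomes the correction of independent classical
  errors. Incoherent operations can do this because a Kraus operator may send a whole fibre of
  \<open>f\<close> to one basis vector with arbitrary phases: merging a fibre compares the relative
  phases inside it, while the characters of words of \<open>W\<close> are constant on fibres and
  survive. The Bhattacharyya bound replaces typicality arguments and gives an exponential estimate
  for every \<open>n\<close>.

  A separate obstacle is that \<open>msqrt\<close> is a definite description, so no fidelity can be
  evaluated before existence and uniqueness of positive semidefinite roots are known. Existence is
  drawn from the Jordan normal form over the complex numbers, which supplies an invertible but not a
  unitary change of basis. Just two kinds of fidelity are ever computed: a diagonal state against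
  itself, and an arbitrary state against a pure one.\<close>

lemma dim_adj [simp]: "dim_row (adj A) = dim_col A" "dim_col (adj A) = dim_row A"
  by (simp_all add: adj_def)

lemma adj_carrier [simp]: "A \<in> carrier_mat n m \<Longrightarrow> adj A \<in> carrier_mat m n"
  by auto

lemma index_adj [simp]: "i < dim_col A \<Longrightarrow> j < dim_row A \<Longrightarrow> adj A $$ (i,j) = cnj (A $$ (j,i))"
  by (simp add: adj_def)

lemma adj_adj [simp]: "adj (adj A) = A"
  by (rule eq_matI) auto

lemma adj_one [simp]: "adj (1\<^sub>m n) = 1\<^sub>m n"
  by (rule eq_matI) auto

lemma mult_index:
  fixes A B :: "'a :: semiring_0 mat"
  assumes "A \<in> carrier_mat n m" "B \<in> carrier_mat m k" "i < n" "j < k"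
  shows "(A * B) $$ (i,j) = (\<Sum>l<m. A $$ (i,l) * B $$ (l,j))"
  using assms by (auto simp: scalar_prod_def atLeast0LessThan intro!: sum.cong)

lemma mult3_index:
  fixes A B C :: "complex mat"
  assumes "A \<in> carrier_mat n m" "B \<in> carrier_mat m k" "C \<in> carrier_mat k l" "i < n" "j < l"
  shows "(A * B * C) $$ (i,j) = (\<Sum>x<m. \<Sum>y<k. A $$ (i,x) * B $$ (x,y) * C $$ (y,j))"
proof -
  have "(A * B * C) $$ (i,j) = (\<Sum>y<k. (\<Sum>x<m. A $$ (i,x) * B $$ (x,y)) * C $$ (y,j))"
    using assms by (subst mult_index[of _ n k _ l]) (auto intro!: sum.cong simp: mult_index[of A n m B k] simp del: index_mult_mat(1))
  also have "\<dots> = (\<Sum>y<k. \<Sum>x<m. A $$ (i,x) * B $$ (x,y) * C $$ (y,j))"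
    by (simp add: sum_distrib_right)
  also have "\<dots> = (\<Sum>x<m. \<Sum>y<k. A $$ (i,x) * B $$ (x,y) * C $$ (y,j))"
    by (rule sum.swap)
  finally show ?thesis .
qed

lemma adj_mult:
  assumes "A \<in> carrier_mat n m" "B \<in> carrier_mat m k"
  shows "adj (A * B) = adj B * adj A"
proof (rule eq_matI)
  fix i j assume "i < dim_row (adj B * adj A)" "j < dim_col (adj B * adj A)"
  then have ij: "i < k" "j < n" using assms by auto
  have "adj (A * B) $$ (i,j) = cnj ((A * B) $$ (j,i))" using ij assms by simp
  also have "\<dots> = (\<Sum>l<m. adj B $$ (i,l) * adj A $$ (l,j))"
    using ij assms by (subst mult_index[OF assms]) (auto simp: mult.commute)
  also have "\<dots> = (adj B * adj A) $$ (i,j)"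
    using ij assms by (subst mult_index[of _ k m _ n]) auto
  finally show "adj (A * B) $$ (i,j) = (adj B * adj A) $$ (i,j)" .
qed (use assms in auto)

lemma adj_minus:
  assumes "A \<in> carrier_mat n m" "B \<in> carrier_mat n m"
  shows "adj (A - B) = adj A - adj B"
  using assms by (intro eq_matI) auto

lemma quad_form:
  assumes "A \<in> carrier_mat n n" "v \<in> carrier_vec n"
  shows "conjugate v \<bullet> (A *\<^sub>v v) = (\<Sum>i<n. \<Sum>j<n. cnj (v $ i) * A $$ (i,j) * v $ j)"
  using assms
  by (auto simp: scalar_prod_def atLeast0LessThan mult_mat_vec_def sum_distrib_left mult.assoc intro!: sum.cong)

lemma adj_scalar_prod:
  assumes A: "A \<in> carrier_mat n m" and u: "u \<in> carrier_vec n" and v: "v \<in> carrier_vec m"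
  shows "conjugate u \<bullet> (A *\<^sub>v v) = conjugate (adj A *\<^sub>v u) \<bullet> v"
proof -
  have "conjugate u \<bullet> (A *\<^sub>v v) = (\<Sum>i<n. \<Sum>j<m. cnj (u $ i) * A $$ (i,j) * v $ j)"
    using assms
    by (auto simp: scalar_prod_def atLeast0LessThan mult_mat_vec_def sum_distrib_left mult.assoc intro!: sum.cong)
  also have "\<dots> = (\<Sum>j<m. \<Sum>i<n. cnj (u $ i) * A $$ (i,j) * v $ j)" by (rule sum.swap)
  also have "\<dots> = conjugate (adj A *\<^sub>v u) \<bullet> v"
    using assms
    by (auto simp: scalar_prod_def atLeast0LessThan mult_mat_vec_def sum_distrib_left sum_distrib_right mult_ac intro!: sum.cong)
  finally show ?thesis .
qed

lemma self_scalar_prod: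
  fixes v :: "complex vec"
  assumes "v \<in> carrier_vec n"
  shows "conjugate v \<bullet> v = complex_of_real (\<Sum>i<n. (cmod (v $ i))\<^sup>2)"
  using assms unfolding of_real_sum
  by (auto simp: scalar_prod_def atLeast0LessThan complex_norm_square mult.commute simp del: of_real_power intro!: sum.cong)

lemma self_scalar_prod_eq_0:
  fixes v :: "complex vec"
  assumes v: "v \<in> carrier_vec n" and 0: "conjugate v \<bullet> v = 0"
  shows "v = 0\<^sub>v n"
proof (rule eq_vecI)
  fix i assume i: "i < dim_vec (0\<^sub>v n :: complex vec)"
  have "(\<Sum>i<n. (cmod (v $ i))\<^sup>2) = 0"
    using 0 unfolding self_scalar_prod[OF v] by (simp only: of_real_eq_0_iff)
  then have "\<forall>i\<in>{..<n}. (cmod (v $ i))\<^sup>2 = 0"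
    by (subst (asm) sum_nonneg_eq_0_iff) auto
  then show "v $ i = 0\<^sub>v n $ i" using i by auto
qed (use v in auto)

lemma psdD:
  assumes "psd n A"
  shows "A \<in> carrier_mat n n" "adj A = A"
    "v \<in> carrier_vec n \<Longrightarrow> 0 \<le> Re (conjugate v \<bullet> (A *\<^sub>v v))"
  using assms by (auto simp: psd_def)

lemma psd_gram:
  assumes C: "C \<in> carrier_mat m n"
  shows "psd n (adj C * C)"
  unfolding psd_def
proof (intro conjI ballI)
  show "adj (adj C * C) = adj C * C"
    using C by (subst adj_mult[of _ n m _ n]) auto
  fix v :: "complex vec" assume v: "v \<in> carrier_vec n"
  have "conjugate v \<bullet> ((adj C * C) *\<^sub>v v) = conjugate v \<bullet> (adj C *\<^sub>v (C *\<^sub>v v))"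
    using C v by (subst assoc_mult_mat_vec[of _ n m _ n]) auto
  also have "\<dots> = conjugate (C *\<^sub>v v) \<bullet> (C *\<^sub>v v)"
    using C v by (subst adj_scalar_prod[of _ n m]) auto
  finally show "0 \<le> Re (conjugate v \<bullet> ((adj C * C) *\<^sub>v v))"
    using self_scalar_prod[of "C *\<^sub>v v" m] C v by (simp add: sum_nonneg)
qed (use C in auto)

section \<open>Spectral decomposition from the Jordan form\<close>

text \<open>A block of size at least 2 contributes, in its first two columns, an eigenvector and a
  generalized eigenvector above it; without such a block nothing lies off the diagonal. The second
  alternative is the one that Hermiticity excludes.\<close>

lemma jordan_matrix_cases:
  fixes n_as :: "(nat \<times> 'a :: {zero,one}) list"
  defines "J \<equiv> jordan_matrix n_as" and "N \<equiv> sum_list (map fst n_as)"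
  shows "(\<forall>i<N. \<forall>j<N. i \<noteq> j \<longrightarrow> J $$ (i,j) = 0) \<or>
    (\<exists>s a. Suc s < N \<and> (\<forall>i<N. J $$ (i,s) = (if i = s then a else 0) \<and>
       J $$ (i,Suc s) = (if i = Suc s then a else if i = s then 1 else 0)))"
  unfolding J_def N_def
proof (induction n_as)
  case Nil
  then show ?case by simp
next
  case (Cons na n_as)
  obtain n a where na: "na = (n,a)" by force
  let ?M = "sum_list (map fst n_as)" and ?J = "jordan_matrix n_as"
  let ?K = "jordan_matrix (na # n_as)"
  have idx: "?K $$ (i,j) = (if i < n then if j < n then jordan_block n a $$ (i,j) else 0
      else if j < n then 0 else ?J $$ (i - n, j - n))" if "i < n + ?M" "j < n + ?M" for i j
    using that unfolding na jordan_matrix_Cons by (auto simp: index_mat_four_block)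
  show ?case
  proof (cases "n \<ge> 2")
    case True
    have "\<forall>i<n + ?M. ?K $$ (i,0) = (if i = 0 then a else 0) \<and>
       ?K $$ (i,Suc 0) = (if i = Suc 0 then a else if i = 0 then 1 else 0)"
      using True by (auto simp: idx jordan_block_def)
    then show ?thesis
      using True unfolding na by (intro disjI2 exI[of _ 0] exI[of _ a]) auto
  next
    case False
    from Cons.IH show ?thesis
    proof (elim disjE)
      assume H: "\<forall>i<?M. \<forall>j<?M. i \<noteq> j \<longrightarrow> ?J $$ (i,j) = 0"
      show ?thesis
        using H False by (intro disjI1) (auto simp: idx[unfolded na] na jordan_block_def)
    next
      assume "\<exists>s a. Suc s < ?M \<and> (\<forall>i<?M. ?J $$ (i,s) = (if i = s then a else 0) \<and>
       ?J $$ (i,Suc s) = (if i = Suc s then a else if i = s then 1 else 0))"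
      then obtain s b where s: "Suc s < ?M" and H: "\<And>i. i < ?M \<Longrightarrow> ?J $$ (i,s) = (if i = s then b else 0)"
        "\<And>i. i < ?M \<Longrightarrow> ?J $$ (i,Suc s) = (if i = Suc s then b else if i = s then 1 else 0)"
        by blast
      have "\<forall>i<n + ?M. ?K $$ (i,n+s) = (if i = n+s then b else 0) \<and>
         ?K $$ (i,Suc (n+s)) = (if i = Suc (n+s) then b else if i = n+s then 1 else 0)"
      proof (intro allI impI)
        fix i assume i: "i < n + ?M"
        have e: "Suc (n+s) - n = Suc s" by simp
        show "?K $$ (i,n+s) = (if i = n+s then b else 0) \<and>
         ?K $$ (i,Suc (n+s)) = (if i = Suc (n+s) then b else if i = n+s then 1 else 0)"
          using i s by (subst (1 2) idx) (auto simp: H e)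
      qed
      then show ?thesis
        using s unfolding na by (intro disjI2 exI[of _ "n+s"] exI[of _ b]) auto
    qed
  qed
qed

lemma hermitian_eigenvalue_real:
  assumes A: "A \<in> carrier_mat n n" "adj A = A" and w: "w \<in> carrier_vec n" "w \<noteq> 0\<^sub>v n"
    and e: "A *\<^sub>v w = a \<cdot>\<^sub>v w"
  shows "cnj a = a"
proof -
  have "conjugate w \<bullet> (A *\<^sub>v w) = a * (conjugate w \<bullet> w)"
    using w unfolding e by simp
  moreover have "conjugate w \<bullet> (A *\<^sub>v w) = cnj a * (conjugate w \<bullet> w)"
    using w A by (subst adj_scalar_prod[of _ n n]) (auto simp: e conjugate_smult_vec)
  moreover have "conjugate w \<bullet> w \<noteq> 0"
    using self_scalar_prod_eq_0 w by blast
  ultimately show ?thesis by simp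
qed

text \<open>The inner product of \<open>w\<close> with \<open>A u\<close> is \<open>a\<close> times
  that of \<open>w\<close> with \<open>u\<close> when \<open>A\<close> is moved to the other side,
  but exceeds this by the squared norm of \<open>w\<close> when the chain relation is used.\<close>

lemma hermitian_no_jordan_chain:
  assumes A: "A \<in> carrier_mat n n" "adj A = A" and w: "w \<in> carrier_vec n" and u: "u \<in> carrier_vec n"
    and ew: "A *\<^sub>v w = a \<cdot>\<^sub>v w" and eu: "A *\<^sub>v u = a \<cdot>\<^sub>v u + w"
  shows "w = 0\<^sub>v n"
proof (rule ccontr)
  assume nz: "w \<noteq> 0\<^sub>v n"
  have a: "cnj a = a" using hermitian_eigenvalue_real[OF A w nz ew] .
  have "conjugate w \<bullet> (A *\<^sub>v u) = a * (conjugate w \<bullet> u) + conjugate w \<bullet> w"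
    using w u unfolding eu by (subst scalar_prod_add_distrib[of _ n]) auto
  moreover have "conjugate w \<bullet> (A *\<^sub>v u) = a * (conjugate w \<bullet> u)"
    using w u A by (subst adj_scalar_prod[of _ n n]) (auto simp: ew a conjugate_smult_vec)
  ultimately have "conjugate w \<bullet> w = 0" by simp
  then show False using self_scalar_prod_eq_0 w nz by blast
qed

definition rdiag :: "nat \<Rightarrow> (nat \<Rightarrow> real) \<Rightarrow> complex mat" where
  "rdiag n r = mat n n (\<lambda>(i,j). if i = j then complex_of_real (r i) else 0)"

lemma rdiag_carrier [simp]: "rdiag n r \<in> carrier_mat n n" "dim_row (rdiag n r) = n" "dim_col (rdiag n r) = n"
  by (auto simp: rdiag_def)

lemma index_rdiag [simp]: "i < n \<Longrightarrow> j < n \<Longrightarrow> rdiag n r $$ (i,j) = (if i = j then complex_of_real (r i) else 0)"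
  by (simp add: rdiag_def)

lemma adj_rdiag [simp]: "adj (rdiag n r) = rdiag n r"
  by (rule eq_matI) auto

lemma mult_rdiag_index:
  assumes "M \<in> carrier_mat m n" "i < m" "j < n"
  shows "(M * rdiag n r) $$ (i,j) = M $$ (i,j) * complex_of_real (r j)"
proof -
  have "(M * rdiag n r) $$ (i,j) = (\<Sum>l<n. M $$ (i,l) * rdiag n r $$ (l,j))"
    by (rule mult_index) (use assms in auto)
  also have "\<dots> = (\<Sum>l<n. if l = j then M $$ (i,j) * complex_of_real (r j) else 0)"
    by (rule sum.cong) (use assms in auto)
  also have "\<dots> = M $$ (i,j) * complex_of_real (r j)" using assms by simp
  finally show ?thesis .
qed

lemma rdiag_mult_index:
  assumes "M \<in> carrier_mat n m" "i < n" "j < m"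
  shows "(rdiag n r * M) $$ (i,j) = complex_of_real (r i) * M $$ (i,j)"
proof -
  have "(rdiag n r * M) $$ (i,j) = (\<Sum>l<n. rdiag n r $$ (i,l) * M $$ (l,j))"
    by (rule mult_index) (use assms in auto)
  also have "\<dots> = (\<Sum>l<n. if i = l then complex_of_real (r i) * M $$ (i,j) else 0)"
    by (rule sum.cong) (use assms in auto)
  also have "\<dots> = complex_of_real (r i) * M $$ (i,j)" using assms by simp
  finally show ?thesis .
qed

lemma rdiag_mult [simp]: "rdiag n r * rdiag n s = rdiag n (\<lambda>i. r i * s i)"
  by (rule eq_matI) (auto simp: mult_rdiag_index[of _ n n] simp del: index_mult_mat(1))

lemma rdiag_cong: "(\<And>i. i < n \<Longrightarrow> r i = s i) \<Longrightarrow> rdiag n r = rdiag n s"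
  by (rule eq_matI) auto

lemma tr_rdiag: "tr (rdiag n r) = complex_of_real (\<Sum>i<n. r i)"
  by (simp add: tr_def)

lemma psd_rdiag:
  assumes "\<And>i. i < n \<Longrightarrow> 0 \<le> r i"
  shows "psd n (rdiag n r)"
proof -
  have "psd n (adj (rdiag n (\<lambda>i. sqrt (r i))) * rdiag n (\<lambda>i. sqrt (r i)))"
    by (rule psd_gram[of _ n]) simp
  also have "adj (rdiag n (\<lambda>i. sqrt (r i))) * rdiag n (\<lambda>i. sqrt (r i)) = rdiag n r"
    using assms by (simp cong: rdiag_cong)
  finally show ?thesis .
qed

text \<open>The last property says that the Gram matrix of the eigenvectors commutes with every function
  of the eigenvalues; this makes \<open>P * rdiag n (f \<circ> r) * Q\<close> Hermitian although \<open>P\<close> need not be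
  unitary.\<close>
lemma psd_diagonalizable:
  assumes psd: "psd n A"
  obtains P Q r where "P \<in> carrier_mat n n" "Q \<in> carrier_mat n n" "P * Q = 1\<^sub>m n" "Q * P = 1\<^sub>m n"
    "A = P * rdiag n r * Q" "\<And>i. i < n \<Longrightarrow> 0 \<le> r i"
    "\<And>i j. i < n \<Longrightarrow> j < n \<Longrightarrow> (adj P * P) $$ (i,j) \<noteq> 0 \<Longrightarrow> r i = r j"
proof -
  note A = psdD(1)[OF psd] and H = psdD(2)[OF psd]
  obtain as where "char_poly A = (\<Prod>a\<leftarrow>as. [:- a, 1:])"
    using char_poly_factorized[OF A] by blast
  then obtain n_as where "jordan_nf A n_as"
    using jordan_nf_exists[OF A] by blast
  then obtain P Q where wit: "similar_mat_wit A (jordan_matrix n_as) P Q"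
    unfolding jordan_nf_def similar_mat_def by blast
  define J where "J = jordan_matrix n_as"
  from similar_mat_witD2[OF A wit]
  have PQ: "P * Q = 1\<^sub>m n" "Q * P = 1\<^sub>m n" "A = P * J * Q" "J \<in> carrier_mat n n"
    "P \<in> carrier_mat n n" "Q \<in> carrier_mat n n" unfolding J_def by auto
  have dimJ: "sum_list (map fst n_as) = n"
    using PQ(4) unfolding J_def by auto
  \<comment> \<open>Read column by column, this says that the columns of \<open>P\<close> are the
    vectors of the Jordan chains.\<close>
  have "A * P = P * J * (Q * P)"
    unfolding PQ(3) by (rule assoc_mult_mat) (use PQ in auto)
  then have AP: "A * P = P * J" using PQ by simp
  have evec: "(A *\<^sub>v col P s) $ i = (P * J) $$ (i,s)" if "s < n" "i < n" for s i
    using col_mult2[OF A PQ(5) that(1)] AP index_col[of i "P * J" s] that PQ(4,5)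
    by (metis carrier_matD index_mult_mat(2,3))
  have colnz: "col P s \<noteq> 0\<^sub>v n" if "s < n" for s
  proof
    assume "col P s = 0\<^sub>v n"
    then have "(Q * P) $$ (s,s) = 0" using that PQ(5,6) by simp
    then show False using that PQ by simp
  qed
  have colJ: "(P * J) $$ (i,s) = (\<Sum>k<n. P $$ (i,k) * J $$ (k,s))" if "i < n" "s < n" for i s
    using mult_index[OF PQ(5,4) that] .
  have diag: "\<forall>i<n. \<forall>j<n. i \<noteq> j \<longrightarrow> J $$ (i,j) = 0"
  proof (rule ccontr)
    assume "\<not> ?thesis"
    then obtain s a where s: "Suc s < n" and J1: "\<And>i. i < n \<Longrightarrow> J $$ (i,s) = (if i = s then a else 0)"
      and J2: "\<And>i. i < n \<Longrightarrow> J $$ (i,Suc s) = (if i = Suc s then a else if i = s then 1 else 0)"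
      using jordan_matrix_cases[of n_as] unfolding J_def dimJ by blast
    have e1: "A *\<^sub>v col P s = a \<cdot>\<^sub>v col P s"
    proof (rule eq_vecI)
      fix i assume "i < dim_vec (a \<cdot>\<^sub>v col P s)"
      then have i: "i < n" using PQ by simp
      have "(P * J) $$ (i,s) = (\<Sum>k<n. if k = s then P $$ (i,s) * a else 0)"
        using s i unfolding colJ[OF i Suc_lessD[OF s]] by (intro sum.cong) (auto simp: J1)
      then have "(P * J) $$ (i,s) = P $$ (i,s) * a" using s by simp
      then show "(A *\<^sub>v col P s) $ i = (a \<cdot>\<^sub>v col P s) $ i"
        using s i PQ(4-6) unfolding evec[OF Suc_lessD[OF s] i] by (simp del: index_mult_mat(1))
    qed (use A PQ in auto)
    have e2: "A *\<^sub>v col P (Suc s) = a \<cdot>\<^sub>v col P (Suc s) + col P s"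
    proof (rule eq_vecI)
      fix i assume "i < dim_vec (a \<cdot>\<^sub>v col P (Suc s) + col P s)"
      then have i: "i < n" using PQ by simp
      have "(P * J) $$ (i,Suc s) = (\<Sum>k<n. (if k = Suc s then P $$ (i,Suc s) * a else 0) + (if k = s then P $$ (i,s) else 0))"
        using s i unfolding colJ[OF i s] by (intro sum.cong) (auto simp: J2)
      then have "(P * J) $$ (i,Suc s) = P $$ (i,Suc s) * a + P $$ (i,s)"
        using s by (simp add: sum.distrib)
      then show "(A *\<^sub>v col P (Suc s)) $ i = (a \<cdot>\<^sub>v col P (Suc s) + col P s) $ i"
        using s i PQ(4-6) unfolding evec[OF s i] by (simp del: index_mult_mat(1))
    qed (use A PQ in auto)
    have "col P s = 0\<^sub>v n"
      by (rule hermitian_no_jordan_chain[OF A H _ _ e1 e2]) (use PQ s in \<open>auto simp: col_def\<close>)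
    with colnz s show False by auto
  qed
  define r where "r i = Re (J $$ (i,i))" for i
  have ev: "A *\<^sub>v col P s = J $$ (s,s) \<cdot>\<^sub>v col P s" if s: "s < n" for s
  proof (rule eq_vecI)
    fix i assume "i < dim_vec (J $$ (s,s) \<cdot>\<^sub>v col P s)"
    then have i: "i < n" using PQ by simp
    have "(P * J) $$ (i,s) = (\<Sum>k<n. if k = s then P $$ (i,s) * J $$ (s,s) else 0)"
      using s i diag unfolding colJ[OF i s] by (intro sum.cong) auto
    then have "(P * J) $$ (i,s) = P $$ (i,s) * J $$ (s,s)" using s by simp
    then show "(A *\<^sub>v col P s) $ i = (J $$ (s,s) \<cdot>\<^sub>v col P s) $ i"
      using s i PQ(4-6) unfolding evec[OF s i] by (simp del: index_mult_mat(1))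
  qed (use A PQ in auto)
  have colP: "col P s \<in> carrier_vec n" for s using PQ by (auto simp: col_def)
  have Jr: "J $$ (s,s) = complex_of_real (r s) \<and> 0 \<le> r s" if s: "s < n" for s
  proof
    have "cnj (J $$ (s,s)) = J $$ (s,s)"
      by (rule hermitian_eigenvalue_real[OF A H colP colnz[OF s] ev[OF s]])
    then show *: "J $$ (s,s) = complex_of_real (r s)"
      unfolding r_def by (simp add: complex_eq_iff)
    define m where "m = (\<Sum>i<n. (cmod (col P s $ i))\<^sup>2)"
    have m: "conjugate (col P s) \<bullet> col P s = complex_of_real m"
      unfolding m_def by (rule self_scalar_prod[OF colP])
    have "m \<noteq> 0" using m self_scalar_prod_eq_0[OF colP] colnz[OF s] by auto
    moreover have "m \<ge> 0" unfolding m_def by (simp add: sum_nonneg)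
    moreover have "conjugate (col P s) \<bullet> (A *\<^sub>v col P s) = complex_of_real (r s * m)"
      using colP unfolding ev[OF s] by (simp add: m *)
    then have "0 \<le> r s * m"
      using psdD(3)[OF psd colP, of s] by simp
    ultimately show "0 \<le> r s" by (simp add: zero_le_mult_iff)
  qed
  have Jd: "J = rdiag n r"
    by (rule eq_matI) (use PQ(4) diag Jr in auto)
  \<comment> \<open>\<open>adj P * A * P\<close> is Hermitian and equals the Gram matrix times the
    diagonal of eigenvalues. Taking adjoints shows that the two factors commute, so a Gram entry can
    be nonzero only between equal eigenvalues.\<close>
  have "adj P * A * P = adj P * (A * P)"
    by (rule assoc_mult_mat) (use A PQ(5) in auto)
  also have "\<dots> = adj P * (P * rdiag n r)" by (simp only: AP Jd)
  also have "\<dots> = adj P * P * rdiag n r"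
    by (rule assoc_mult_mat[symmetric]) (use PQ(5) in auto)
  finally have "adj P * A * P = adj P * P * rdiag n r" .
  moreover have "adj (adj P * A * P) = adj P * A * P"
    using A PQ(5) H by (simp add: adj_mult[of _ n n _ n] assoc_mult_mat[of _ n n _ n _ n])
  moreover have "adj (adj P * P * rdiag n r) = rdiag n r * (adj P * P)"
    using PQ(5) by (simp add: adj_mult[of _ n n _ n] assoc_mult_mat[of _ n n _ n _ n])
  ultimately have comm: "adj P * P * rdiag n r = rdiag n r * (adj P * P)" by simp
  have rr: "r i = r j" if "i < n" "j < n" "(adj P * P) $$ (i,j) \<noteq> 0" for i j
  proof -
    have c: "adj P * P \<in> carrier_mat n n" using PQ by auto
    have "(adj P * P) $$ (i,j) * complex_of_real (r j) = complex_of_real (r i) * (adj P * P) $$ (i,j)"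
      using mult_rdiag_index[OF c that(1,2), of r] rdiag_mult_index[OF c that(1,2), of r] comm
      by metis
    then show ?thesis using that(3) by (auto simp del: index_mult_mat(1))
  qed
  show thesis
    by (rule that[of P Q r]) (use PQ Jd Jr rr in auto)
qed

section \<open>Square roots of positive semidefinite matrices\<close>

lemma psd_sqrt_exists:
  assumes "psd n A"
  shows "\<exists>B. psd n B \<and> B * B = A"
proof -
  obtain P Q r where PQ: "P \<in> carrier_mat n n" "Q \<in> carrier_mat n n" "P * Q = 1\<^sub>m n" "Q * P = 1\<^sub>m n"
    and A: "A = P * rdiag n r * Q" and r: "\<And>i. i < n \<Longrightarrow> 0 \<le> r i"
    and rr: "\<And>i j. i < n \<Longrightarrow> j < n \<Longrightarrow> (adj P * P) $$ (i,j) \<noteq> 0 \<Longrightarrow> r i = r j"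
    using psd_diagonalizable[OF assms] by blast
  note ass = assoc_mult_mat[of _ n n _ n _ n]
  have QPX: "Q * (P * X) = X" if "X \<in> carrier_mat n n" for X
    using PQ that by (subst assoc_mult_mat[of _ n n _ n _ n, symmetric]) auto
  have mul: "(P * rdiag n f * Q) * (P * rdiag n g * Q) = P * rdiag n (\<lambda>i. f i * g i) * Q" for f g
  proof -
    have "(P * rdiag n f * Q) * (P * rdiag n g * Q) = P * (rdiag n f * (Q * (P * (rdiag n g * Q))))"
      using PQ by (simp add: ass mult_carrier_mat[of _ n n])
    also have "\<dots> = P * (rdiag n f * (rdiag n g * Q))"
      using PQ by (subst QPX) auto
    also have "\<dots> = P * ((rdiag n f * rdiag n g) * Q)"
      using PQ by (subst assoc_mult_mat[of "rdiag n f" n n]) auto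
    also have "\<dots> = P * rdiag n (\<lambda>i. f i * g i) * Q"
      using PQ by (simp add: ass)
    finally show ?thesis .
  qed
  \<comment> \<open>Fourth roots: the square root of \<open>A\<close> will be \<open>G * G\<close>,
    and once \<open>G\<close> is Hermitian this is a Gram matrix, hence positive
    semidefinite.\<close>
  define f where "f i = sqrt (sqrt (r i))" for i
  define G where "G = P * rdiag n f * Q"
  have G: "G \<in> carrier_mat n n" unfolding G_def using PQ by auto
  have c: "adj P * P \<in> carrier_mat n n" using PQ by auto
  \<comment> \<open>Where the Gram entry is nonzero the eigenvalues coincide, and so do the values
    of \<open>f\<close>.\<close>
  have comm: "adj P * P * rdiag n f = rdiag n f * (adj P * P)"
  proof (rule eq_matI)
    fix i j assume "i < dim_row (rdiag n f * (adj P * P))" "j < dim_col (rdiag n f * (adj P * P))"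
    then have ij: "i < n" "j < n" using PQ by auto
    show "(adj P * P * rdiag n f) $$ (i,j) = (rdiag n f * (adj P * P)) $$ (i,j)"
      using rr[OF ij] unfolding mult_rdiag_index[OF c ij, of f] rdiag_mult_index[OF c ij, of f]
      by (cases "(adj P * P) $$ (i,j) = 0") (auto simp: f_def simp del: index_mult_mat(1))
  qed (use PQ in auto)
  have "adj Q * adj P = 1\<^sub>m n"
    using PQ by (subst adj_mult[of P n n Q n, symmetric]) auto
  then have QPadj: "adj Q * (adj P * X) = X" if "X \<in> carrier_mat n n" for X
    using PQ that by (subst assoc_mult_mat[of _ n n _ n _ n, symmetric]) auto
  \<comment> \<open>Appending \<open>P * Q\<close> creates the factor \<open>adj P * P\<close>, past
    which \<open>rdiag n f\<close> can move; \<open>adj Q\<close> then cancels \<open>adj P\<close>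
    and \<open>G\<close> remains.\<close>
  have "adj G = adj Q * adj (P * rdiag n f)"
    unfolding G_def by (rule adj_mult[of _ n n _ n]) (use PQ in auto)
  also have "adj (P * rdiag n f) = rdiag n f * adj P"
    using PQ by (subst adj_mult[of _ n n _ n]) auto
  also have "adj Q * (rdiag n f * adj P) = adj Q * rdiag n f * adj P * (P * Q)"
    using PQ by (simp add: ass)
  also have "\<dots> = adj Q * (rdiag n f * (adj P * P)) * Q"
    using PQ by (simp add: ass mult_carrier_mat[of _ n n])
  also have "\<dots> = adj Q * (adj P * P * rdiag n f) * Q" by (simp only: comm)
  also have "\<dots> = G"
    unfolding G_def using PQ by (simp add: ass QPadj mult_carrier_mat[of _ n n])
  finally have adjG: "adj G = G" .
  have "psd n (G * G)" using psd_gram[OF G] by (simp add: adjG)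
  moreover have "(G * G) * (G * G) = A"
    unfolding G_def mul A using r
    by (simp add: f_def cong: rdiag_cong)
  ultimately show ?thesis by blast
qed

lemma psd_factor:
  assumes "psd n A"
  obtains C where "C \<in> carrier_mat n n" "adj C * C = A"
  using psd_sqrt_exists[OF assms] psdD by metis

lemma psd_congruence:
  assumes A: "psd n A" and K: "K \<in> carrier_mat m n"
  shows "psd m (K * A * adj K)"
proof -
  obtain C where C: "C \<in> carrier_mat n n" "adj C * C = A" using psd_factor[OF A] .
  have Kc: "adj K \<in> carrier_mat n m" using K by simp
  have "K * A * adj K = K * (adj C * C * adj K)"
    unfolding C(2) by (rule assoc_mult_mat[of _ m n _ n _ m]) (use K psdD(1)[OF A] in auto)
  also have "\<dots> = K * (adj C * (C * adj K))"
    using C(1) Kc by (subst assoc_mult_mat[of "adj C" n n C n _ m]) auto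
  also have "\<dots> = K * adj C * (C * adj K)"
    using C(1) K Kc by (subst assoc_mult_mat[of K m n "adj C" n _ m]) auto
  also have "\<dots> = adj (C * adj K) * (C * adj K)"
    using adj_mult[OF C(1) Kc] by simp
  finally have "K * A * adj K = adj (C * adj K) * (C * adj K)" .
  moreover have "psd m (adj (C * adj K) * (C * adj K))"
    by (rule psd_gram[of _ n]) (use C K in auto)
  ultimately show ?thesis by simp
qed

lemma psd_add:
  assumes "psd n A" "psd n B"
  shows "psd n (A + B)"
  unfolding psd_def
proof (intro conjI ballI)
  note c = psdD(1)[OF assms(1)] psdD(1)[OF assms(2)]
  have "adj (A + B) = adj A + adj B" using c by (intro eq_matI) auto
  then show "adj (A + B) = A + B" using psdD(2)[OF assms(1)] psdD(2)[OF assms(2)] by simp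
  show "A + B \<in> carrier_mat n n" using c by auto
  fix v :: "complex vec" assume v: "v \<in> carrier_vec n"
  have "conjugate v \<bullet> ((A + B) *\<^sub>v v) = conjugate v \<bullet> (A *\<^sub>v v) + conjugate v \<bullet> (B *\<^sub>v v)"
    using v c by (subst add_mult_distrib_mat_vec[of _ n n]) (auto intro!: scalar_prod_add_distrib[of _ n])
  then show "0 \<le> Re (conjugate v \<bullet> ((A + B) *\<^sub>v v))"
    using psdD(3)[OF assms(1) v] psdD(3)[OF assms(2) v] by simp
qed

text \<open>The diagonal entries of a Gram matrix are the squared norms of the columns.\<close>

lemma gram_eq_0:
  assumes C: "C \<in> carrier_mat m n" and D: "\<And>i. i < n \<Longrightarrow> Re ((adj C * C) $$ (i,i)) = 0"
  shows "C = 0\<^sub>m m n"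
proof (rule eq_matI)
  fix i j assume "i < dim_row (0\<^sub>m m n :: complex mat)" "j < dim_col (0\<^sub>m m n :: complex mat)"
  then have ij: "i < m" "j < n" by auto
  have "(adj C * C) $$ (j,j) = (\<Sum>l<m. cnj (C $$ (l,j)) * C $$ (l,j))"
    using C ij by (subst mult_index[of _ n m _ n]) (auto intro!: sum.cong)
  also have "\<dots> = complex_of_real (\<Sum>l<m. (cmod (C $$ (l,j)))\<^sup>2)"
    unfolding of_real_sum by (rule sum.cong) (auto simp: complex_norm_square mult.commute simp del: of_real_power)
  finally have "(\<Sum>l<m. (cmod (C $$ (l,j)))\<^sup>2) = 0" using D[OF ij(2)] by (simp del: index_mult_mat(1))
  then have "\<forall>l\<in>{..<m}. (cmod (C $$ (l,j)))\<^sup>2 = 0"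
    by (subst (asm) sum_nonneg_eq_0_iff) auto
  then show "C $$ (i,j) = 0\<^sub>m m n $$ (i,j)" using ij by auto
qed (use C in auto)

lemma gram_diag_nonneg:
  assumes C: "C \<in> carrier_mat m n" and i: "i < n"
  shows "0 \<le> Re ((adj C * C) $$ (i,i))"
proof -
  have "(adj C * C) $$ (i,i) = (\<Sum>l<m. cnj (C $$ (l,i)) * C $$ (l,i))"
    using C i by (subst mult_index[of _ n m _ n]) (auto intro!: sum.cong)
  then show ?thesis by (simp add: sum_nonneg power2_eq_square[symmetric] del: index_mult_mat(1))
qed

lemma tr_comm:
  assumes "A \<in> carrier_mat n m" "B \<in> carrier_mat m n"
  shows "tr (A * B) = tr (B * A)"
proof -
  have "tr (A * B) = (\<Sum>i<n. \<Sum>l<m. A $$ (i,l) * B $$ (l,i))"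
    unfolding tr_def using assms by (auto intro!: sum.cong simp: mult_index[of _ n m _ n] simp del: index_mult_mat(1))
  also have "\<dots> = (\<Sum>l<m. \<Sum>i<n. A $$ (i,l) * B $$ (l,i))" by (rule sum.swap)
  also have "\<dots> = tr (B * A)"
    unfolding tr_def using assms
    by (auto intro!: sum.cong simp: mult_index[of _ m n _ m] mult.commute simp del: index_mult_mat(1))
  finally show ?thesis .
qed

text \<open>For \<open>X = B - C\<close>, the mixed terms cancel in
  \<open>B * X + X * C = B * B - C * C = 0\<close>. Multiplying by \<open>X\<close> on the left and
  taking traces gives that the traces of \<open>X B X\<close> and \<open>X C X\<close> add up to 0.
  Both are traces of Gram matrices, so \<open>B * X\<close> and \<open>C * X\<close> vanish, and
  with them \<open>X * X\<close>. This works without knowing that \<open>B\<close> and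
  \<open>C\<close> commute.\<close>

lemma psd_sqrt_unique:
  assumes B: "psd n B" and C: "psd n C" and eq: "B * B = C * C"
  shows "B = C"
proof -
  note Bc = psdD(1)[OF B] and Cc = psdD(1)[OF C] and BH = psdD(2)[OF B] and CH = psdD(2)[OF C]
  define X where "X = B - C"
  have X: "X \<in> carrier_mat n n" unfolding X_def using Cc by (rule minus_carrier_mat)
  have XH: "adj X = X" unfolding X_def using Bc Cc BH CH by (simp add: adj_minus[of _ n n])
  note ass = assoc_mult_mat[of _ n n _ n _ n]
  obtain E where E: "E \<in> carrier_mat n n" "adj E * E = B" using psd_factor[OF B] .
  obtain F where F: "F \<in> carrier_mat n n" "adj F * F = C" using psd_factor[OF C] .
  have EX: "adj (E * X) * (E * X) = X * (B * X)"
    using E(1) X by (simp add: adj_mult[of _ n n _ n] XH ass E(2)[symmetric])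
  have FX: "adj (F * X) * (F * X) = X * (C * X)"
    using F(1) X by (simp add: adj_mult[of _ n n _ n] XH ass F(2)[symmetric])
  have sum0: "B * X + X * C = 0\<^sub>m n n"
  proof -
    have "B * X = B * B - B * C" unfolding X_def by (rule mult_minus_distrib_mat[OF Bc Bc Cc])
    moreover have "X * C = B * C - C * C" unfolding X_def by (rule minus_mult_distrib_mat[OF Bc Cc Cc])
    ultimately show ?thesis unfolding eq using Bc Cc by (intro eq_matI) auto
  qed
  have "X * (B * X) + X * (X * C) = X * (B * X + X * C)"
    by (rule mult_add_distrib_mat[symmetric]) (use X Bc Cc in auto)
  then have "X * (B * X) + X * (X * C) = 0\<^sub>m n n" using X sum0 by simp
  then have "tr (X * (B * X) + X * (X * C)) = 0" by (simp add: tr_def)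
  moreover have "tr (X * (B * X) + X * (X * C)) = tr (X * (B * X)) + tr (X * (X * C))"
    unfolding tr_def using X Bc Cc by (simp add: sum.distrib del: index_mult_mat(1))
  moreover have "tr (X * (X * C)) = tr (X * (C * X))"
    using tr_comm[of X n n "X * C"] X Cc by (simp add: ass)
  ultimately have "tr (adj (E * X) * (E * X)) + tr (adj (F * X) * (F * X)) = 0"
    by (simp add: EX FX)
  then have z: "(\<Sum>i<n. Re ((adj (E * X) * (E * X)) $$ (i,i))) + (\<Sum>i<n. Re ((adj (F * X) * (F * X)) $$ (i,i))) = 0"
    unfolding tr_def using E(1) F(1) X by (simp add: Re_sum[symmetric] del: Re_sum index_mult_mat(1) flip: plus_complex.sel)
  have EXc: "E * X \<in> carrier_mat n n" and FXc: "F * X \<in> carrier_mat n n" using E F X by auto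
  have "(\<Sum>i<n. Re ((adj (E * X) * (E * X)) $$ (i,i))) = 0" "(\<Sum>i<n. Re ((adj (F * X) * (F * X)) $$ (i,i))) = 0"
    using z sum_nonneg[of "{..<n}" "\<lambda>i. Re ((adj (E * X) * (E * X)) $$ (i,i))"]
      sum_nonneg[of "{..<n}" "\<lambda>i. Re ((adj (F * X) * (F * X)) $$ (i,i))"]
      gram_diag_nonneg[OF EXc] gram_diag_nonneg[OF FXc] by (force simp del: index_mult_mat(1))+
  then have "\<forall>i\<in>{..<n}. Re ((adj (E * X) * (E * X)) $$ (i,i)) = 0" "\<forall>i\<in>{..<n}. Re ((adj (F * X) * (F * X)) $$ (i,i)) = 0"
    using sum_nonneg_eq_0_iff[of "{..<n}" "\<lambda>i. Re ((adj (E * X) * (E * X)) $$ (i,i))"]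
      sum_nonneg_eq_0_iff[of "{..<n}" "\<lambda>i. Re ((adj (F * X) * (F * X)) $$ (i,i))"]
      gram_diag_nonneg[OF EXc] gram_diag_nonneg[OF FXc] by (simp_all del: index_mult_mat(1))
  then have "E * X = 0\<^sub>m n n" "F * X = 0\<^sub>m n n"
    by (auto intro!: gram_eq_0[OF EXc] gram_eq_0[OF FXc])
  then have "B * X = 0\<^sub>m n n" "C * X = 0\<^sub>m n n"
    using E F X by (simp_all add: ass E(2)[symmetric] F(2)[symmetric])
  moreover have "X * X = B * X - C * X"
    by (subst (1) X_def) (rule minus_mult_distrib_mat[OF Bc Cc X])
  ultimately have "adj X * X = 0\<^sub>m n n" by (simp add: XH)
  then have "X = 0\<^sub>m n n" by (intro gram_eq_0[OF X]) simp
  show ?thesis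
  proof (rule eq_matI)
    fix i j assume ij: "i < dim_row C" "j < dim_col C"
    have "X $$ (i,j) = 0" using \<open>X = 0\<^sub>m n n\<close> ij Cc by simp
    then show "B $$ (i,j) = C $$ (i,j)" unfolding X_def using ij by simp
  qed (use Bc Cc in auto)
qed

lemma msqrt_eqI:
  assumes "psd n B" "B * B = A"
  shows "msqrt A = B"
proof -
  have "dim_row A = n" using assms psdD(1) by force
  then show ?thesis
    unfolding msqrt_def using assms by (intro the_equality) (auto intro: psd_sqrt_unique)
qed

lemma msqrt_psd:
  assumes "psd n A"
  shows "psd n (msqrt A)" "msqrt A * msqrt A = A"
  using psd_sqrt_exists[OF assms] msqrt_eqI by metis+

section \<open>Evaluation of the fidelity\<close>

lemma fidelity_rdiag_self:
  assumes "\<And>i. i < n \<Longrightarrow> 0 \<le> p i"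
  shows "fidelity (rdiag n p) (rdiag n p) = complex_of_real (\<Sum>i<n. p i)"
proof -
  have 1: "msqrt (rdiag n p) = rdiag n (\<lambda>i. sqrt (p i))"
    by (rule msqrt_eqI[of n]) (auto intro!: psd_rdiag rdiag_cong simp: assms)
  have "msqrt (rdiag n (\<lambda>i. sqrt (p i) * p i * sqrt (p i))) = rdiag n p"
    by (rule msqrt_eqI[of n]) (auto intro!: psd_rdiag rdiag_cong simp: assms)
  then show ?thesis unfolding fidelity_def 1 by (simp add: tr_rdiag)
qed

text \<open>With \<open>C\<close> the root of \<open>\<omega>\<close> and
  \<open>u = C *\<^sub>v f\<close>, the matrix under the outer root is the rank-one matrix of
  \<open>u\<close>. Its root is the same matrix divided by the norm of \<open>u\<close>, so the
  trace is that norm. The vector \<open>f\<close> may have any length.\<close>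

lemma fidelity_pure:
  assumes \<omega>: "psd N \<omega>" and f: "f \<in> carrier_vec N"
  shows "fidelity \<omega> (mat N N (\<lambda>(i,j). f $ i * cnj (f $ j))) = complex_of_real (sqrt (Re (conjugate f \<bullet> (\<omega> *\<^sub>v f))))"
proof -
  define C where "C = msqrt \<omega>"
  have C: "psd N C" "C * C = \<omega>" unfolding C_def using msqrt_psd[OF \<omega>] by auto
  note Cc = psdD(1)[OF C(1)] and CH = psdD(2)[OF C(1)]
  define u where "u = C *\<^sub>v f"
  have u: "u \<in> carrier_vec N" unfolding u_def using Cc f by auto
  define t where "t = (\<Sum>i<N. (cmod (u $ i))\<^sup>2)"
  have t0: "t \<ge> 0" unfolding t_def by (simp add: sum_nonneg)
  have "conjugate f \<bullet> (\<omega> *\<^sub>v f) = conjugate f \<bullet> (C *\<^sub>v u)"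
    unfolding C(2)[symmetric] u_def using Cc f by (subst assoc_mult_mat_vec[of _ N N _ N]) auto
  also have "\<dots> = conjugate u \<bullet> u"
    using Cc f u by (subst adj_scalar_prod[of _ N N]) (auto simp: CH u_def)
  also have "\<dots> = complex_of_real t" unfolding t_def by (rule self_scalar_prod[OF u])
  finally have t: "Re (conjugate f \<bullet> (\<omega> *\<^sub>v f)) = t" by simp
  define U where "U c = mat N N (\<lambda>(i,j). complex_of_real c * (u $ i * cnj (u $ j)))" for c
  have Uc: "U c \<in> carrier_mat N N" for c by (simp add: U_def)
  have fu: "u $ i = (\<Sum>x<N. C $$ (i,x) * f $ x)" if "i < N" for i
    unfolding u_def using that Cc f by (auto simp: scalar_prod_def atLeast0LessThan intro!: sum.cong)
  have Ch: "cnj (C $$ (i,x)) = C $$ (x,i)" if "i < N" "x < N" for i x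
    using that CH Cc by (metis carrier_matD index_adj)
  have 1: "C * mat N N (\<lambda>(i,j). f $ i * cnj (f $ j)) * C = U 1"
  proof (rule eq_matI)
    fix i j assume "i < dim_row (U 1)" "j < dim_col (U 1)"
    then have ij: "i < N" "j < N" by (auto simp: U_def)
    have "(C * mat N N (\<lambda>(i,j). f $ i * cnj (f $ j)) * C) $$ (i,j)
       = (\<Sum>x<N. \<Sum>y<N. (C $$ (i,x) * f $ x) * cnj (C $$ (j,y) * f $ y))"
      using ij Cc by (subst mult3_index[of _ N N _ N _ N]) (auto simp: Ch mult_ac intro!: sum.cong)
    also have "\<dots> = u $ i * cnj (u $ j)"
      using ij by (simp add: fu sum_product)
    finally show "(C * mat N N (\<lambda>(i,j). f $ i * cnj (f $ j)) * C) $$ (i,j) = U 1 $$ (i,j)"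
      using ij by (simp add: U_def)
  qed (use Cc in \<open>auto simp: U_def\<close>)
  have uu: "(\<Sum>k<N. cnj (u $ k) * u $ k) = complex_of_real t"
    unfolding t_def of_real_sum by (rule sum.cong) (auto simp: complex_norm_square mult.commute simp del: of_real_power)
  have mul: "U a * U b = U (a * b * t)" for a b
  proof (rule eq_matI)
    fix i j assume "i < dim_row (U (a * b * t))" "j < dim_col (U (a * b * t))"
    then have ij: "i < N" "j < N" by (auto simp: U_def)
    have "(U a * U b) $$ (i,j) = (\<Sum>k<N. (complex_of_real (a * b) * (u $ i * cnj (u $ j))) * (cnj (u $ k) * u $ k))"
      using ij by (subst mult_index[OF Uc Uc]) (auto simp: U_def mult_ac intro!: sum.cong)
    also have "\<dots> = complex_of_real (a * b) * (u $ i * cnj (u $ j)) * complex_of_real t"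
      unfolding sum_distrib_left[symmetric] uu ..
    finally show "(U a * U b) $$ (i,j) = U (a * b * t) $$ (i,j)"
      using ij by (simp add: U_def mult_ac)
  qed (auto simp: U_def)
  have z: "u $ i = 0" if "t = 0" "i < N" for i
  proof -
    have "\<forall>i\<in>{..<N}. (cmod (u $ i))\<^sup>2 = 0"
      using that(1) unfolding t_def by (subst (asm) sum_nonneg_eq_0_iff) auto
    then show ?thesis using that(2) by simp
  qed
  have Up: "psd N (U (1 / sqrt t))"
  proof -
    define c where "c = sqrt (1 / sqrt t)"
    have c: "c * c = 1 / sqrt t" unfolding c_def using t0 by simp
    \<comment> \<open>A Gram factor whose single nonzero row is the scaled conjugate of
      \<open>u\<close>.\<close>
    define D where "D = mat N N (\<lambda>(i,j). if i = 0 then complex_of_real c * cnj (u $ j) else 0)"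
    have D: "D \<in> carrier_mat N N" by (simp add: D_def)
    have "adj D * D = U (1 / sqrt t)"
    proof (rule eq_matI)
      fix i j assume "i < dim_row (U (1 / sqrt t))" "j < dim_col (U (1 / sqrt t))"
      then have ij: "i < N" "j < N" by (auto simp: U_def)
      have "(adj D * D) $$ (i,j) = (\<Sum>k<N. if k = 0 then complex_of_real (c * c) * (u $ i * cnj (u $ j)) else 0)"
        using ij D by (subst mult_index[of _ N N _ N]) (auto simp only: intro!: sum.cong, auto simp: D_def)
      also have "\<dots> = complex_of_real (1 / sqrt t) * (u $ i * cnj (u $ j))"
        using ij by (simp add: c)
      finally show "(adj D * D) $$ (i,j) = U (1 / sqrt t) $$ (i,j)"
        using ij by (simp add: U_def)
    qed (auto simp: D_def U_def)
    then show ?thesis using psd_gram[OF D] by simp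
  qed
  \<comment> \<open>For \<open>t = 0\<close> the scale \<open>1 / sqrt t\<close> is 0 by the
    convention for division, and both sides are zero because \<open>u\<close> vanishes.\<close>
  have sq: "U (1 / sqrt t) * U (1 / sqrt t) = U 1"
  proof (cases "t = 0")
    case True
    then show ?thesis unfolding mul by (intro eq_matI) (auto simp: U_def z)
  next
    case False
    then show ?thesis unfolding mul using t0 by simp
  qed
  have "fidelity \<omega> (mat N N (\<lambda>(i,j). f $ i * cnj (f $ j))) = tr (U (1 / sqrt t))"
    unfolding fidelity_def C_def[symmetric] 1 msqrt_eqI[OF Up sq] ..
  also have "\<dots> = complex_of_real (1 / sqrt t) * (\<Sum>k<N. cnj (u $ k) * u $ k)"
    unfolding tr_def sum_distrib_left by (auto simp: U_def mult_ac intro!: sum.cong)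
  also have "\<dots> = complex_of_real (sqrt t)"
    unfolding uu by (simp flip: of_real_mult of_real_divide add: real_div_sqrt t0)
  finally show ?thesis unfolding t .
qed

section \<open>Binary linear codes\<close>

lemma xor_less_power2:
  fixes x y n :: nat
  assumes "x < 2 ^ n" "y < 2 ^ n"
  shows "xor x y < 2 ^ n"
  using assms by (simp flip: take_bit_nat_eq_self_iff)

lemma xor_right_cancel [simp]:
  fixes x y :: nat
  shows "xor (xor x y) y = x"
  by (simp add: xor.assoc)

lemma sum_xor_reindex:
  fixes F :: "nat \<Rightarrow> 'a :: comm_monoid_add"
  assumes w: "w < 2 ^ n"
  shows "(\<Sum>x<2^n. F (xor x w)) = (\<Sum>x<2^n. F x)"
  by (rule sum.reindex_bij_witness[of _ "\<lambda>x. xor x w" "\<lambda>x. xor x w"])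
     (auto simp: xor_less_power2 w)

text \<open>Numbers below \<open>2^n\<close> serve as bit strings, and splitting off bit 0 separates
  even from odd numbers. Every reduction of a sum over strings to a one-bit quantity goes through
  this factorization.\<close>

lemma sum_bits_prod:
  fixes h :: "nat \<Rightarrow> bool \<Rightarrow> 'a :: comm_semiring_1"
  shows "(\<Sum>x<2^n. \<Prod>i<n. h i (bit (x::nat) i)) = (\<Prod>i<n. h i False + h i True)"
proof (induction n arbitrary: h)
  case 0
  show ?case by simp
next
  case (Suc n)
  have *: "(\<Sum>x<2*m. F x) = (\<Sum>x<m. F (2*x) + F (Suc (2*x)))" for m :: nat and F :: "nat \<Rightarrow> 'a"
    by (induction m) (auto simp: add_ac)
  have "(\<Sum>x<2^Suc n. \<Prod>i<Suc n. h i (bit (x::nat) i))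
      = (\<Sum>x<2^n. (\<Prod>i<Suc n. h i (bit (2*x) i)) + (\<Prod>i<Suc n. h i (bit (Suc (2*x)) i)))"
    by (simp only: power_Suc *)
  also have "\<dots> = (\<Sum>x<2^n. (h 0 False + h 0 True) * (\<Prod>i<n. h (Suc i) (bit (x::nat) i)))"
    by (intro sum.cong refl) (simp add: prod.lessThan_Suc_shift bit_Suc bit_0 distrib_right del: prod.lessThan_Suc)
  also have "\<dots> = (h 0 False + h 0 True) * (\<Prod>i<n. h (Suc i) False + h (Suc i) True)"
    unfolding sum_distrib_left[symmetric] Suc.IH[of "\<lambda>i. h (Suc i)"] ..
  finally show ?case by (simp add: prod.lessThan_Suc_shift del: prod.lessThan_Suc)
qed

text \<open>The Walsh function: -1 to the power of the inner product of the bit strings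
  \<open>e\<close> and \<open>x\<close>, a row of the unnormalized n-fold Hadamard matrix.\<close>

definition character :: "nat \<Rightarrow> nat \<Rightarrow> nat \<Rightarrow> real" where
  "character n e x = (\<Prod>i<n. if bit e i \<and> bit x i then -1 else 1)"

lemma character_xor_left: "character n (xor d e) x = character n d x * character n e x"
  unfolding character_def prod.distrib[symmetric] by (rule prod.cong) (auto simp: bit_xor_iff)

lemma character_xor_right: "character n e (xor x y) = character n e x * character n e y"
  unfolding character_def prod.distrib[symmetric] by (rule prod.cong) (auto simp: bit_xor_iff)

lemma character_0 [simp]: "character n 0 x = 1" "character n x 0 = 1"
  by (simp_all add: character_def)

lemma character_cases: "character n e x = 1 \<or> character n e x = -1"
  unfolding character_def by (induction n) auto

lemma character_square [simp]: "character n e x * character n e x = 1"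
  using character_cases[of n e x] by auto

text \<open>Orthogonality of characters: any bit set in \<open>z\<close> produces a vanishing factor
  \<open>1 + (-1)\<close>.\<close>

lemma sum_character:
  assumes "z < 2 ^ n"
  shows "(\<Sum>l<2^n. character n l z) = (if z = 0 then 2 ^ n else 0)"
proof -
  have "(\<Sum>l<2^n. character n l z) = (\<Prod>i<n. 1 + (if bit z i then -1 else 1))"
    using sum_bits_prod[where n=n and h="\<lambda>i b. if b \<and> bit z i then -1 else (1::real)"]
    unfolding character_def by simp
  also have "\<dots> = (if z = 0 then 2 ^ n else 0)"
  proof (cases "z = 0")
    case False
    then obtain i where "bit z i" by (metis bit_eqI bit_0_eq bot_apply bot_bool_def)
    moreover have "i < n"
      using \<open>bit z i\<close> assms by (metis bit_take_bit_iff take_bit_nat_eq_self)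
    ultimately show ?thesis using False by (auto intro!: prod_zero bexI[of _ i])
  qed simp
  finally show ?thesis .
qed

section \<open>Choice of the code and of its decoder\<close>

lemma exists_le_average:
  fixes g :: "'a \<Rightarrow> real"
  assumes "finite A" "A \<noteq> {}"
  shows "\<exists>v\<in>A. real (card A) * g v \<le> sum g A"
proof (rule ccontr)
  assume "\<not> ?thesis"
  then have "sum (\<lambda>_. sum g A / card A) A < sum g A"
    using assms by (intro sum_strict_mono) (auto simp: divide_less_eq mult.commute card_gt_0_iff)
  then show False using assms by simp
qed

text \<open>The greedy step behind the Gilbert--Varshamov bound: a generator added to \<open>W\<close> is chosen
  such that the new coset carries at most the average weight. The map \<open>f\<close> records the parities
  of \<open>x\<close> against the generators.\<close>
lemma good_code_exists:
  fixes B :: "nat \<Rightarrow> real"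
  assumes B: "\<And>x. 0 \<le> B x" and "k \<le> n"
  shows "\<exists>W f. W \<subseteq> {..<2^n} \<and> 0 \<in> W \<and> (\<forall>v\<in>W. \<forall>w\<in>W. xor v w \<in> W) \<and> card W = 2 ^ k \<and>
     (\<forall>x. f x < (2 ^ k :: nat)) \<and>
     (\<forall>x y. f x = f y \<longrightarrow> (\<forall>w\<in>W. character n w (xor x y) = 1)) \<and>
     2 ^ n * (\<Sum>w\<in>W - {0}. B w) \<le> 2 * (2 ^ k - 1) * (\<Sum>x<2^n. B x)"
  using \<open>k \<le> n\<close>
proof (induction k)
  case 0
  show ?case
    by (rule exI[of _ "{0}"], rule exI[of _ "\<lambda>_. 0"]) auto
next
  case (Suc k)
  let ?G = "{..<2^n} :: nat set"
  from Suc.IH[OF Suc_leD[OF Suc.prems]] obtain W f where W12: "W \<subseteq> ?G" "0 \<in> W"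
    and W3: "\<forall>v\<in>W. \<forall>w\<in>W. xor v w \<in> W" and W4: "card W = 2 ^ k"
    and f0: "\<forall>x. f x < (2 ^ k :: nat)"
    and fW0: "\<forall>x y. f x = f y \<longrightarrow> (\<forall>w\<in>W. character n w (xor x y) = 1)"
    and cost: "2 ^ n * (\<Sum>w\<in>W - {0}. B w) \<le> 2 * (2 ^ k - 1) * (\<Sum>x<2^n. B x)"
    by (elim exE conjE) (rule that, assumption+)
  have W: "W \<subseteq> ?G" "0 \<in> W" "\<And>v w. v \<in> W \<Longrightarrow> w \<in> W \<Longrightarrow> xor v w \<in> W" "card W = 2 ^ k"
    and f: "\<And>x. f x < (2 ^ k :: nat)"
    and fW: "\<And>x y w. f x = f y \<Longrightarrow> w \<in> W \<Longrightarrow> character n w (xor x y) = 1"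
    using W12 W3 W4 f0 fW0 by auto
  have fin: "finite W" using W(1) finite_subset by blast
  define S where "S = (\<Sum>x<2^n. B x)"
  define g where "g v = (\<Sum>w\<in>W. B (xor v w))" for v
  have cardA: "card (?G - W) = 2 ^ n - 2 ^ k" using W(1,4) fin by (simp add: card_Diff_subset)
  have kn: "2 * 2 ^ k \<le> (2::nat) ^ n" using power_increasing[OF Suc.prems, of "2::nat"] by simp
  have knr: "2 * 2 ^ k \<le> (2::real) ^ n" using power_increasing[OF Suc.prems, of "2::real"] by simp
  have "card (?G - W) > 0" unfolding cardA using kn zero_less_power[of "2::nat" k] by linarith
  then have "?G - W \<noteq> {}" by force
  then obtain v where v: "v \<in> ?G" "v \<notin> W" and vg: "real (card (?G - W)) * g v \<le> sum g (?G - W)"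
    using exists_le_average[of "?G - W" g] by auto
  have g0: "0 \<le> g x" for x unfolding g_def using B by (simp add: sum_nonneg)
  have "sum g (?G - W) \<le> sum g ?G" by (rule sum_mono2) (auto simp: g0)
  also have "sum g ?G = (\<Sum>w\<in>W. \<Sum>x\<in>?G. B (xor x w))" unfolding g_def by (rule sum.swap)
  also have "\<dots> = (\<Sum>w\<in>W. S)" unfolding S_def using W(1) by (intro sum.cong refl sum_xor_reindex) auto
  also have "\<dots> = 2 ^ k * S" by (simp add: W(4))
  finally have "real (card (?G - W)) * g v \<le> 2 ^ k * S" using vg by linarith
  moreover have "real (card (?G - W)) = 2 ^ n - 2 ^ k"
    unfolding cardA using Suc.prems by (subst of_nat_diff) auto
  \<comment> \<open>Because \<open>k < n\<close>, at least half of all strings lie outside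
    \<open>W\<close>. This halving is the source of the factor 2 in the cost bound, and the
    resulting \<open>2 * 2 ^ k\<close> is exactly the increment from \<open>2 * (2 ^ k - 1)\<close>
    to \<open>2 * (2 ^ Suc k - 1)\<close>.\<close>
  moreover have "2 ^ n / 2 * g v \<le> (2 ^ n - 2 ^ k) * g v"
    using knr g0 by (intro mult_right_mono) auto
  ultimately have gv: "2 ^ n * g v \<le> 2 * (2 ^ k * S)" by simp
  define V where "V = xor v ` W"
  have injV: "inj_on (xor v) W" by (rule inj_onI) (metis xor.assoc xor_self_eq xor.left_neutral)
  have VW: "V \<inter> W = {}"
  proof -
    have "xor v w \<notin> W" if "w \<in> W" for w using W(3)[OF _ that, of "xor v w"] v(2) by auto
    then show ?thesis by (auto simp: V_def)
  qed
  \<comment> \<open>The parity against the new generator \<open>v\<close> is stored as bit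
    \<open>k\<close>, which is free because \<open>f x < 2 ^ k\<close>.\<close>
  define f' where "f' x = f x + (if character n v x = 1 then 0 else 2 ^ k)" for x
  have f'_eq: "f x = f y \<and> character n v x = character n v y" if "f' x = f' y" for x y
    using that f[of x] f[of y] character_cases[of n v x] character_cases[of n v y]
    by (auto simp: f'_def split: if_splits)
  show ?case
  proof (rule exI[of _ "W \<union> V"], rule exI[of _ f'], intro conjI allI ballI impI)
    show "W \<union> V \<subseteq> ?G" using W(1) v(1) by (auto simp: V_def intro!: xor_less_power2)
    show "0 \<in> W \<union> V" using W(2) by simp
    show "xor a b \<in> W \<union> V" if ab: "a \<in> W \<union> V" "b \<in> W \<union> V" for a b
    proof -
      have 1: "xor (xor v p) q = xor v (xor p q)" "xor p (xor v q) = xor v (xor p q)"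
        "xor (xor v p) (xor v q) = xor p q" for p q :: nat
        by (rule bit_eqI, auto simp: bit_xor_iff)+
      have V: "xor v p \<in> V" if "p \<in> W" for p using that by (simp add: V_def)
      obtain p where p: "p \<in> W" "a = p \<or> a = xor v p" using ab(1) by (auto simp: V_def)
      obtain q where q: "q \<in> W" "b = q \<or> b = xor v q" using ab(2) by (auto simp: V_def)
      have "xor a b = xor p q \<or> xor a b = xor v (xor p q)"
        using p(2) q(2) 1[of p q] by auto
      then show ?thesis using V W(3) p(1) q(1) by auto
    qed
    show "card (W \<union> V) = 2 ^ Suc k"
      using VW fin W(4) card_image[OF injV] by (simp add: card_Un_disjoint Int_commute V_def)
    show "f' x < 2 ^ Suc k" for x using f[of x] by (simp add: f'_def)
    show "character n w (xor x y) = 1" if e: "f' x = f' y" and w: "w \<in> W \<union> V" for x y w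
    proof -
      have "character n v (xor x y) = 1"
        using f'_eq[OF e] by (simp add: character_xor_right)
      then show ?thesis
        using w fW[of x y] f'_eq[OF e] by (auto simp: V_def character_xor_left)
    qed
    have "(\<Sum>w\<in>(W \<union> V) - {0}. B w) = (\<Sum>w\<in>(W - {0}) \<union> V. B w)"
      using VW W(2) by (intro sum.cong) auto
    also have "\<dots> = (\<Sum>w\<in>W - {0}. B w) + g v"
      using VW fin by (subst sum.union_disjoint) (auto simp: V_def g_def sum.reindex[OF injV])
    finally show "2 ^ n * (\<Sum>w\<in>(W \<union> V) - {0}. B w) \<le> 2 * (2 ^ Suc k - 1) * (\<Sum>x<2^n. B x)"
      using cost gv unfolding S_def[symmetric] by (simp add: algebra_simps)
  qed
qed

text \<open>\<open>D\<close> is the maximum likelihood decoder, picking a most likely element of each coset of \<open>W\<close>.\<close>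
lemma coset_decoder_exists:
  fixes p :: "nat \<Rightarrow> real"
  assumes p: "\<And>x. 0 \<le> p x" and p1: "(\<Sum>x<2^n. p x) = 1"
    and W: "W \<subseteq> {..<2^n}" "0 \<in> W" "\<And>v w. v \<in> W \<Longrightarrow> w \<in> W \<Longrightarrow> xor v w \<in> W"
  obtains D where "\<And>l. l < 2 ^ n \<Longrightarrow> D l < 2 ^ n" "\<And>l. xor l (D l) \<in> W"
    "(\<Sum>l<2^n. p (D l)) \<le> real (card W)"
    "real (card W) * (1 - (\<Sum>w\<in>W - {0}. \<Sum>x<2^n. sqrt (p x * p (xor x w)))) \<le> (\<Sum>l<2^n. p (D l))"
proof -
  have fin: "finite W" using W(1) finite_subset by blast
  have "\<exists>w\<in>W. \<forall>u\<in>W. p (xor l u) \<le> p (xor l w)" for l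
  proof -
    have "Max ((\<lambda>u. p (xor l u)) ` W) \<in> (\<lambda>u. p (xor l u)) ` W"
      using fin W(2) by (intro Max_in) auto
    then obtain w where "w \<in> W" "p (xor l w) = Max ((\<lambda>u. p (xor l u)) ` W)" by auto
    then show ?thesis using fin by (intro bexI[of _ w]) auto
  qed
  then obtain c where c: "\<And>l. c l \<in> W" "\<And>l u. u \<in> W \<Longrightarrow> p (xor l u) \<le> p (xor l (c l))" by metis
  define D where "D l = xor l (c l)" for l
  have lD: "xor l (D l) = c l" for l by (simp add: D_def flip: xor.assoc)
  have cc: "xor (c l) (xor (c l) w) = w" for l w by (simp flip: xor.assoc)
  have coset: "(\<Sum>w\<in>W. F (xor (D l) w)) = (\<Sum>w\<in>W. F (xor l w))" for F :: "nat \<Rightarrow> real" and l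
    by (rule sum.reindex_bij_witness[of _ "xor (c l)" "xor (c l)"])
       (auto simp: D_def W(3) c(1) xor.assoc cc)
  \<comment> \<open>Letting \<open>l\<close> run over all strings visits each coset once for each of
    its elements; therefore all probabilities and success weights below carry a factor
    \<open>card W\<close>.\<close>
  have total: "(\<Sum>l<2^n. \<Sum>w\<in>W. p (xor l w)) = real (card W)"
  proof -
    have "(\<Sum>l<2^n. \<Sum>w\<in>W. p (xor l w)) = (\<Sum>w\<in>W. \<Sum>l<2^n. p (xor l w))" by (rule sum.swap)
    also have "\<dots> = (\<Sum>w\<in>W. 1)"
      by (rule sum.cong[OF refl], subst sum_xor_reindex) (use W(1) p1 in auto)
    finally show ?thesis by simp
  qed
  define b where "b w x = sqrt (p x * p (xor x w))" for w x
  have b0: "0 \<le> b w x" for w x unfolding b_def using p by simp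
  have split: "(\<Sum>w\<in>W. p (xor l w)) = p (D l) + (\<Sum>w\<in>W - {0}. p (xor (D l) w))" for l
    unfolding coset[of p l, symmetric] using sum.remove[OF fin W(2), of "\<lambda>w. p (xor (D l) w)"] by simp
  \<comment> \<open>An element of the coset other than \<open>D l\<close> has probability at most
    \<open>p (D l)\<close>, hence at most the geometric mean of the two. Where \<open>D l\<close>
    sits in its coset is not under control, so this mean is enlarged to a sum over the whole coset;
    averaging over \<open>l\<close> makes that sum explicit.\<close>
  have "(\<Sum>w\<in>W. p (xor l w)) \<le> p (D l) + (\<Sum>w\<in>W - {0}. \<Sum>u\<in>W. b w (xor l u))" for l
  proof -
    have "p (xor (D l) w) \<le> (\<Sum>u\<in>W. b w (xor l u))" if w: "w \<in> W" for w
    proof -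
      have "xor (c l) w \<in> W" using c(1) w W(3) by blast
      then have "p (xor (D l) w) \<le> p (D l)"
        using c(2)[of "xor (c l) w" l] by (simp add: D_def xor.assoc)
      then have "(p (xor (D l) w))\<^sup>2 \<le> p (D l) * p (xor (D l) w)"
        unfolding power2_eq_square using p by (intro mult_right_mono)
      then have "p (xor (D l) w) \<le> b w (xor l (c l))"
        unfolding b_def D_def[symmetric] by (rule real_le_rsqrt)
      also have "\<dots> \<le> (\<Sum>u\<in>W. b w (xor l u))"
        using c(1) fin b0 by (intro member_le_sum) auto
      finally show ?thesis .
    qed
    then show ?thesis unfolding split by (intro add_left_mono sum_mono) auto
  qed
  then have "(\<Sum>l<2^n. \<Sum>w\<in>W. p (xor l w)) \<le> (\<Sum>l<2^n. p (D l) + (\<Sum>w\<in>W - {0}. \<Sum>u\<in>W. b w (xor l u)))"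
    by (intro sum_mono)
  also have "\<dots> = (\<Sum>l<2^n. p (D l)) + (\<Sum>w\<in>W - {0}. \<Sum>l<2^n. \<Sum>u\<in>W. b w (xor l u))"
    unfolding sum.distrib by (subst sum.swap) simp
  also have "(\<Sum>w\<in>W - {0}. \<Sum>l<2^n. \<Sum>u\<in>W. b w (xor l u)) = (\<Sum>w\<in>W - {0}. real (card W) * (\<Sum>x<2^n. b w x))"
  proof (rule sum.cong[OF refl])
    fix w
    have "(\<Sum>l<2^n. \<Sum>u\<in>W. b w (xor l u)) = (\<Sum>u\<in>W. \<Sum>l<2^n. b w (xor l u))" by (rule sum.swap)
    also have "\<dots> = (\<Sum>u\<in>W. \<Sum>x<2^n. b w x)"
      using W(1) by (intro sum.cong refl sum_xor_reindex) auto
    finally show "(\<Sum>l<2^n. \<Sum>u\<in>W. b w (xor l u)) = real (card W) * (\<Sum>x<2^n. b w x)" by simp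
  qed
  finally have lower: "real (card W) * (1 - (\<Sum>w\<in>W - {0}. \<Sum>x<2^n. b w x)) \<le> (\<Sum>l<2^n. p (D l))"
    unfolding total by (simp add: sum_distrib_left algebra_simps)
  have "(\<Sum>l<2^n. p (D l)) \<le> (\<Sum>l<2^n. \<Sum>w\<in>W. p (xor l w))"
    unfolding split using p by (intro sum_mono) (simp add: sum_nonneg)
  then have upper: "(\<Sum>l<2^n. p (D l)) \<le> real (card W)" unfolding total .
  show thesis
    by (rule that[of D]) (use lower upper c(1) W(1) lD in \<open>auto simp: b_def D_def intro!: xor_less_power2\<close>)
qed

section \<open>Kronecker products and incoherent operations\<close>

lemma sum_div_mod:
  fixes F :: "nat \<Rightarrow> nat \<Rightarrow> 'a :: comm_monoid_add"
  shows "(\<Sum>k<m*n. F (k div n) (k mod n)) = (\<Sum>i<m. \<Sum>j<n. F i j)"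
proof -
  have "(\<Sum>k<m*n. F (k div n) (k mod n)) = (\<Sum>i<m. \<Sum>k=i*n..<i*n+n. F (k div n) (k mod n))"
    by (rule sum.nat_group[symmetric])
  also have "\<dots> = (\<Sum>i<m. \<Sum>j<n. F i j)"
  proof (rule sum.cong[OF refl])
    fix i
    have "(\<Sum>k=i*n..<i*n+n. F (k div n) (k mod n)) = (\<Sum>j=0..<n. F ((j + i*n) div n) ((j + i*n) mod n))"
      using sum.shift_bounds_nat_ivl[of "\<lambda>k. F (k div n) (k mod n)" 0 "i*n" n] by (simp add: add.commute)
    also have "\<dots> = (\<Sum>j<n. F i j)"
      by (rule sum.cong) auto
    finally show "(\<Sum>k=i*n..<i*n+n. F (k div n) (k mod n)) = (\<Sum>j<n. F i j)" .
  qed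
  finally show ?thesis .
qed

lemma dim_kron [simp]: "dim_row (kron A B) = dim_row A * dim_row B" "dim_col (kron A B) = dim_col A * dim_col B"
  by (simp_all add: kron_def)

lemma kron_carrier [simp]:
  "A \<in> carrier_mat m n \<Longrightarrow> B \<in> carrier_mat k l \<Longrightarrow> kron A B \<in> carrier_mat (m * k) (n * l)"
  by auto

lemma kron_index:
  assumes "A \<in> carrier_mat m n" "B \<in> carrier_mat k l" "i < m * k" "j < n * l"
  shows "kron A B $$ (i,j) = A $$ (i div k, j div l) * B $$ (i mod k, j mod l)"
  using assms by (auto simp: kron_def)

lemma div_mod_less:
  fixes i m n :: nat
  assumes "i < m * n"
  shows "i div n < m" "i mod n < n"
  using assms by (auto simp: less_mult_imp_div_less intro!: mod_less_divisor Nat.gr0I)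

lemma kron_mult:
  assumes A: "A \<in> carrier_mat m n" and B: "B \<in> carrier_mat k l"
    and C: "C \<in> carrier_mat n p" and D: "D \<in> carrier_mat l q"
  shows "kron A B * kron C D = kron (A * C) (B * D)"
proof (rule eq_matI)
  fix i j assume "i < dim_row (kron (A * C) (B * D))" "j < dim_col (kron (A * C) (B * D))"
  then have ij: "i < m * k" "j < p * q" using A B C D by auto
  note dm = div_mod_less[OF ij(1)] div_mod_less[OF ij(2)]
  have "(kron A B * kron C D) $$ (i,j) = (\<Sum>x<n*l. kron A B $$ (i,x) * kron C D $$ (x,j))"
    by (rule mult_index) (use A B C D ij in auto)
  also have "\<dots> = (\<Sum>x<n*l. (\<lambda>u v. (A $$ (i div k, u) * C $$ (u, j div q)) * (B $$ (i mod k, v) * D $$ (v, j mod q))) (x div l) (x mod l))"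
    using ij by (intro sum.cong) (auto simp: kron_index[OF A B] kron_index[OF C D] mult_ac)
  also have "\<dots> = (\<Sum>u<n. \<Sum>v<l. (A $$ (i div k, u) * C $$ (u, j div q)) * (B $$ (i mod k, v) * D $$ (v, j mod q)))"
    by (rule sum_div_mod)
  also have "\<dots> = (A * C) $$ (i div k, j div q) * (B * D) $$ (i mod k, j mod q)"
    unfolding mult_index[OF A C dm(1,3)] mult_index[OF B D dm(2,4)] by (simp add: sum_product)
  also have "\<dots> = kron (A * C) (B * D) $$ (i,j)"
    by (rule kron_index[symmetric]) (use A B C D ij in auto)
  finally show "(kron A B * kron C D) $$ (i,j) = kron (A * C) (B * D) $$ (i,j)" .
qed (use A B C D in auto)

lemma adj_kron: "adj (kron A B) = kron (adj A) (adj B)"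
  by (rule eq_matI) (auto simp: kron_def div_mod_less less_mult_imp_div_less)

lemma kron_one [simp]: "kron (1\<^sub>m m) (1\<^sub>m n) = 1\<^sub>m (m * n)"
proof (rule eq_matI)
  fix i j assume "i < dim_row (1\<^sub>m (m * n) :: complex mat)" "j < dim_col (1\<^sub>m (m * n) :: complex mat)"
  then have ij: "i < m * n" "j < m * n" by auto
  have "i = j \<longleftrightarrow> i div n = j div n \<and> i mod n = j mod n"
    by (metis div_mult_mod_eq)
  then show "kron (1\<^sub>m m) (1\<^sub>m n) $$ (i,j) = 1\<^sub>m (m * n) $$ (i,j)"
    using ij div_mod_less[OF ij(1)] div_mod_less[OF ij(2)] by (auto simp: kron_def)
qed auto

lemma psd_kron:
  assumes "psd m A" "psd n B"
  shows "psd (m * n) (kron A B)"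
proof -
  obtain C where C: "C \<in> carrier_mat m m" "adj C * C = A" using psd_factor[OF assms(1)] .
  obtain D where D: "D \<in> carrier_mat n n" "adj D * D = B" using psd_factor[OF assms(2)] .
  have "kron A B = adj (kron C D) * kron C D"
    unfolding adj_kron C(2)[symmetric] D(2)[symmetric]
    by (rule kron_mult[symmetric]) (use C D in auto)
  then show ?thesis using psd_gram[of "kron C D" "m * n" "m * n"] C D by simp
qed

lemma psd_one: "psd n (1\<^sub>m n)"
  using psd_gram[of "1\<^sub>m n" n n] by simp

lemma psd_zero: "psd n (0\<^sub>m n n)"
  using psd_gram[of "0\<^sub>m n n" n n] by simp

lemma tpow_carrier: "A \<in> carrier_mat m n \<Longrightarrow> tpow k A \<in> carrier_mat (m ^ k) (n ^ k)"
  by (induction k) auto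

lemma psd_tpow: "psd m A \<Longrightarrow> psd (m ^ k) (tpow k A)"
  by (induction k) (auto intro: psd_one psd_kron)

lemma foldr_add_carrier:
  "(\<And>K. K \<in> set Ks \<Longrightarrow> F K \<in> carrier_mat n m) \<Longrightarrow> foldr (\<lambda>K acc. F K + acc) Ks (0\<^sub>m n m) \<in> carrier_mat n m"
  by (induction Ks) auto

lemma foldr_add_index:
  assumes "\<And>K. K \<in> set Ks \<Longrightarrow> F K \<in> carrier_mat n m" and ij: "i < n" "j < m"
  shows "foldr (\<lambda>K acc. F K + acc) Ks (0\<^sub>m n m) $$ (i,j) = (\<Sum>K\<leftarrow>Ks. F K $$ (i,j) :: complex)"
  using assms(1)
proof (induction Ks)
  case (Cons K Ks)
  then have "foldr (\<lambda>K acc. F K + acc) Ks (0\<^sub>m n m) \<in> carrier_mat n m"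
    by (intro foldr_add_carrier) auto
  then show ?case using Cons ij by simp
qed (use ij in simp)

lemma sum_list_product:
  "(\<Sum>z\<leftarrow>concat (map (\<lambda>a. map (g a) ys) xs). F z) = (\<Sum>a\<leftarrow>xs. \<Sum>b\<leftarrow>ys. F (g a b))"
  by (induction xs) (auto simp: o_def)

lemma sum_list_upt: "(\<Sum>l\<leftarrow>[0..<n]. F l) = (\<Sum>l<n. F l)"
  by (simp add: interv_sum_list_conv_sum_set_nat atLeast0LessThan)

lemma sum_list_sum:
  fixes F :: "'a \<Rightarrow> 'b \<Rightarrow> 'c :: comm_monoid_add"
  shows "(\<Sum>a\<leftarrow>xs. \<Sum>b\<in>B. F a b) = (\<Sum>b\<in>B. \<Sum>a\<leftarrow>xs. F a b)"
  by (induction xs) (auto simp: sum.distrib)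

lemma sum_list_swap:
  fixes F :: "'a \<Rightarrow> 'b \<Rightarrow> 'c :: comm_monoid_add"
  shows "(\<Sum>a\<leftarrow>xs. \<Sum>b\<leftarrow>ys. F a b) = (\<Sum>b\<leftarrow>ys. \<Sum>a\<leftarrow>xs. F a b)"
  by (induction xs) (auto simp: sum_list_addf)

lemma sum_list_cong:
  "(\<And>x. x \<in> set xs \<Longrightarrow> f x = g x) \<Longrightarrow> (\<Sum>x\<leftarrow>xs. f x) = (\<Sum>x\<leftarrow>xs. g x)"
  by (metis map_cong)

lemma kraus_term_carrier: "K \<in> carrier_mat n m \<Longrightarrow> K * \<rho> * adj K \<in> carrier_mat n n"
  by auto

lemma apply_op_carrier:
  assumes "\<And>K. K \<in> set Ks \<Longrightarrow> K \<in> carrier_mat n m"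
  shows "apply_op n Ks \<rho> \<in> carrier_mat n n"
  unfolding apply_op_def using assms by (intro foldr_add_carrier kraus_term_carrier)

lemma apply_op_index:
  assumes "\<And>K. K \<in> set Ks \<Longrightarrow> K \<in> carrier_mat n m" "i < n" "j < n"
  shows "apply_op n Ks \<rho> $$ (i,j) = (\<Sum>K\<leftarrow>Ks. (K * \<rho> * adj K) $$ (i,j))"
  unfolding apply_op_def using assms by (intro foldr_add_index kraus_term_carrier)

lemma apply_op_psd:
  assumes "\<And>K. K \<in> set Ks \<Longrightarrow> K \<in> carrier_mat n m" and "psd m \<rho>"
  shows "psd n (apply_op n Ks \<rho>)"
  using assms(1) unfolding apply_op_def
  by (induction Ks) (auto intro: psd_zero psd_add psd_congruence[OF assms(2)])

lemma incoherent_op_carrier: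
  "incoherent_op m n Ks \<Longrightarrow> K \<in> set Ks \<Longrightarrow> K \<in> carrier_mat n m"
  by (simp add: incoherent_op_def incoherent_kraus_op_def)

lemma incoherent_op_complete:
  assumes "incoherent_op m n Ks" "i < m" "j < m"
  shows "(\<Sum>K\<leftarrow>Ks. (adj K * K) $$ (i,j)) = 1\<^sub>m m $$ (i,j)"
proof -
  have "(\<Sum>K\<leftarrow>Ks. (adj K * K) $$ (i,j)) = foldr (\<lambda>K acc. adj K * K + acc) Ks (0\<^sub>m m m) $$ (i,j)"
    by (rule foldr_add_index[symmetric])
       (use assms in \<open>auto dest!: incoherent_op_carrier[OF assms(1)] intro: mult_carrier_mat[of _ _ n]\<close>)
  then show ?thesis using assms by (simp add: incoherent_op_def)
qed

lemma incoherent_opI: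
  assumes K: "\<And>K. K \<in> set Ks \<Longrightarrow> incoherent_kraus_op m n K"
    and C: "\<And>i j. i < m \<Longrightarrow> j < m \<Longrightarrow> (\<Sum>K\<leftarrow>Ks. (adj K * K) $$ (i,j)) = 1\<^sub>m m $$ (i,j)"
  shows "incoherent_op m n Ks"
  unfolding incoherent_op_def
proof (intro conjI ballI)
  have c: "adj K * K \<in> carrier_mat m m" if "K \<in> set Ks" for K
    using K[OF that] by (auto simp: incoherent_kraus_op_def)
  note f = foldr_add_carrier[of Ks "\<lambda>K. adj K * K", OF c]
  show "foldr (\<lambda>K acc. adj K * K + acc) Ks (0\<^sub>m m m) = 1\<^sub>m m"
  proof (rule eq_matI)
    fix i j assume "i < dim_row (1\<^sub>m m :: complex mat)" "j < dim_col (1\<^sub>m m :: complex mat)"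
    then have ij: "i < m" "j < m" by auto
    show "foldr (\<lambda>K acc. adj K * K + acc) Ks (0\<^sub>m m m) $$ (i,j) = 1\<^sub>m m $$ (i,j)"
      using foldr_add_index[of Ks "\<lambda>K. adj K * K", OF c ij] C[OF ij] by simp
  qed (use f in auto)
qed (use K in auto)

lemma incoherent_kraus_op_mult:
  assumes L: "incoherent_kraus_op n k L" and K: "incoherent_kraus_op m n K"
  shows "incoherent_kraus_op m k (L * K)"
  unfolding incoherent_kraus_op_def
proof (intro conjI allI impI)
  have c: "L \<in> carrier_mat k n" "K \<in> carrier_mat n m"
    using assms by (auto simp: incoherent_kraus_op_def)
  then show "L * K \<in> carrier_mat k m" by auto
  fix i assume i: "i < m"
  obtain j where j: "j < n" "\<And>l. l < n \<Longrightarrow> l \<noteq> j \<Longrightarrow> K $$ (l,i) = 0"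
    using K i unfolding incoherent_kraus_op_def by blast
  obtain h where h: "h < k" "\<And>l. l < k \<Longrightarrow> l \<noteq> h \<Longrightarrow> L $$ (l,j) = 0"
    using L j unfolding incoherent_kraus_op_def by blast
  have "(L * K) $$ (l,i) = 0" if "l < k" "l \<noteq> h" for l
    unfolding mult_index[OF c that(1) i]
  proof (intro sum.neutral ballI)
    fix x assume "x \<in> {..<n}"
    then show "L $$ (l,x) * K $$ (x,i) = 0" using j(2)[of x] h(2)[OF that] by (cases "x = j") auto
  qed
  then show "\<exists>j<k. \<forall>l<k. l \<noteq> j \<longrightarrow> (L * K) $$ (l,i) = 0" using h(1) by blast
qed

lemma incoherent_kraus_op_kron:
  assumes K: "incoherent_kraus_op m n K" and L: "incoherent_kraus_op k l L"
  shows "incoherent_kraus_op (m * k) (n * l) (kron K L)"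
  unfolding incoherent_kraus_op_def
proof (intro conjI allI impI)
  have c: "K \<in> carrier_mat n m" "L \<in> carrier_mat l k"
    using assms by (auto simp: incoherent_kraus_op_def)
  then show "kron K L \<in> carrier_mat (n * l) (m * k)" by auto
  fix i assume i: "i < m * k"
  obtain j where j: "j < n" "\<And>x. x < n \<Longrightarrow> x \<noteq> j \<Longrightarrow> K $$ (x,i div k) = 0"
    using K div_mod_less[OF i] unfolding incoherent_kraus_op_def by blast
  obtain h where h: "h < l" "\<And>x. x < l \<Longrightarrow> x \<noteq> h \<Longrightarrow> L $$ (x,i mod k) = 0"
    using L div_mod_less[OF i] unfolding incoherent_kraus_op_def by blast
  have "kron K L $$ (x,i) = 0" if x: "x < n * l" "x \<noteq> j * l + h" for x
  proof -
    have "x div l \<noteq> j \<or> x mod l \<noteq> h" using x(2) by (metis div_mult_mod_eq)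
    then show ?thesis
      using j h div_mod_less[OF x(1)] by (auto simp: kron_index[OF c x(1) i])
  qed
  moreover have "j * l + h < n * l"
  proof -
    have "j * l + h < Suc j * l" using h(1) by simp
    also have "\<dots> \<le> n * l" using j(1) by (intro mult_right_mono) auto
    finally show ?thesis .
  qed
  ultimately show "\<exists>j<n * l. \<forall>x<n * l. x \<noteq> j \<longrightarrow> kron K L $$ (x,i) = 0" by blast
qed

section \<open>Composition and tensor products of operations\<close>

text \<open>\<open>Ls\<close> acts after \<open>Ks\<close>. The enumeration has \<open>Ks\<close>
  outermost, so completeness can collapse the sum over \<open>Ls\<close> for each fixed member of
  \<open>Ks\<close>.\<close>

definition op_comp :: "complex mat list \<Rightarrow> complex mat list \<Rightarrow> complex mat list" where
  "op_comp Ls Ks = concat (map (\<lambda>K. map (\<lambda>L. L * K) Ls) Ks)"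

definition op_kron :: "complex mat list \<Rightarrow> complex mat list \<Rightarrow> complex mat list" where
  "op_kron Ks Ls = concat (map (\<lambda>K. map (kron K) Ls) Ks)"

primrec op_pow :: "nat \<Rightarrow> complex mat list \<Rightarrow> complex mat list" where
  "op_pow 0 Ks = [1\<^sub>m 1]"
| "op_pow (Suc n) Ks = op_kron Ks (op_pow n Ks)"

lemma set_op_comp: "set (op_comp Ls Ks) = {L * K | L K. L \<in> set Ls \<and> K \<in> set Ks}"
  by (auto simp: op_comp_def)

lemma set_op_kron: "set (op_kron Ks Ls) = {kron K L | K L. K \<in> set Ks \<and> L \<in> set Ls}"
  by (auto simp: op_kron_def)

text \<open>The regrouping that nests one Kraus term inside another, stated once so that the
  dimension conditions of associativity are discharged here.\<close>

lemma mult_mat_assoc4: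
  assumes "A \<in> carrier_mat a b" "B \<in> carrier_mat b c" "C \<in> carrier_mat c d" "D \<in> carrier_mat d e" "E \<in> carrier_mat e f"
  shows "(A * B) * C * (D * E) = A * (B * C * D) * (E :: complex mat)"
proof -
  have "(A * B) * C = A * (B * C)" using assms by (intro assoc_mult_mat) auto
  moreover have "(A * (B * C)) * (D * E) = ((A * (B * C)) * D) * E"
    using assms by (intro assoc_mult_mat[symmetric]) auto
  moreover have "A * (B * C) * D = A * (B * C * D)"
    using assms by (intro assoc_mult_mat) auto
  ultimately show ?thesis by simp
qed

lemma incoherent_op_comp:
  assumes L: "incoherent_op n k Ls" and K: "incoherent_op m n Ks"
  shows "incoherent_op m k (op_comp Ls Ks)"
proof (rule incoherent_opI)
  note Lc = incoherent_op_carrier[OF L] and Kc = incoherent_op_carrier[OF K]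
  show "incoherent_kraus_op m k M" if "M \<in> set (op_comp Ls Ks)" for M
    using that L K unfolding set_op_comp incoherent_op_def by (auto intro: incoherent_kraus_op_mult)
  fix i j assume ij: "i < m" "j < m"
  have *: "(\<Sum>L\<leftarrow>Ls. (adj (L * M) * (L * M)) $$ (i,j)) = (adj M * M) $$ (i,j)" if M: "M \<in> set Ks" for M
  proof -
    have Mc: "M \<in> carrier_mat n m" using Kc[OF M] .
    have "(adj (L * M) * (L * M)) $$ (i,j) = (\<Sum>u<n. \<Sum>v<n. adj M $$ (i,u) * (adj L * L) $$ (u,v) * M $$ (v,j))"
      if "L \<in> set Ls" for L
    proof -
      have Lc': "L \<in> carrier_mat k n" using Lc[OF that] .
      \<comment> \<open>An identity matrix placed between \<open>adj L\<close> and \<open>L\<close>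
        makes the product fit the five-factor pattern.\<close>
      have "adj (L * M) * (L * M) = adj M * (adj L * L) * M"
        unfolding adj_mult[OF Lc' Mc] using mult_mat_assoc4[of "adj M" m n "adj L" k "1\<^sub>m k" k L n M m] Lc' Mc
        by simp
      then show ?thesis using Lc' Mc ij by (simp only:, intro mult3_index) auto
    qed
    then have "(\<Sum>L\<leftarrow>Ls. (adj (L * M) * (L * M)) $$ (i,j))
        = (\<Sum>L\<leftarrow>Ls. \<Sum>u<n. \<Sum>v<n. adj M $$ (i,u) * (adj L * L) $$ (u,v) * M $$ (v,j))"
      by (rule sum_list_cong)
    also have "\<dots> = (\<Sum>u<n. \<Sum>v<n. adj M $$ (i,u) * (\<Sum>L\<leftarrow>Ls. (adj L * L) $$ (u,v)) * M $$ (v,j))"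
      by (simp add: sum_list_sum sum_list_const_mult sum_list_mult_const del: index_mult_mat(1))
    also have "\<dots> = (\<Sum>u<n. \<Sum>v<n. adj M $$ (i,u) * 1\<^sub>m n $$ (u,v) * M $$ (v,j))"
      by (intro sum.cong refl) (simp add: incoherent_op_complete[OF L] del: index_mult_mat(1))
    also have "\<dots> = (adj M * 1\<^sub>m n * M) $$ (i,j)"
      using Mc ij by (intro mult3_index[symmetric]) auto
    finally show ?thesis using Mc by simp
  qed
  have "(\<Sum>M\<leftarrow>op_comp Ls Ks. (adj M * M) $$ (i,j)) = (\<Sum>K\<leftarrow>Ks. \<Sum>L\<leftarrow>Ls. (adj (L * K) * (L * K)) $$ (i,j))"
    unfolding op_comp_def by (rule sum_list_product)
  also have "\<dots> = (\<Sum>K\<leftarrow>Ks. (adj K * K) $$ (i,j))" by (rule sum_list_cong) (rule *)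
  also have "\<dots> = 1\<^sub>m m $$ (i,j)" by (rule incoherent_op_complete[OF K ij])
  finally show "(\<Sum>M\<leftarrow>op_comp Ls Ks. (adj M * M) $$ (i,j)) = 1\<^sub>m m $$ (i,j)" .
qed

lemma apply_op_comp:
  assumes Lc: "\<And>L. L \<in> set Ls \<Longrightarrow> L \<in> carrier_mat k n" and Kc: "\<And>K. K \<in> set Ks \<Longrightarrow> K \<in> carrier_mat n m"
    and r: "\<rho> \<in> carrier_mat m m"
  shows "apply_op k (op_comp Ls Ks) \<rho> = apply_op k Ls (apply_op n Ks \<rho>)"
proof -
  have Mc: "M \<in> carrier_mat k m" if "M \<in> set (op_comp Ls Ks)" for M
    using that Lc Kc unfolding set_op_comp by (auto intro!: mult_carrier_mat[of _ k n])
  have Ac: "apply_op n Ks \<rho> \<in> carrier_mat n n" by (rule apply_op_carrier[OF Kc])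
  show ?thesis
  proof (rule eq_matI)
    fix i j assume "i < dim_row (apply_op k Ls (apply_op n Ks \<rho>))" "j < dim_col (apply_op k Ls (apply_op n Ks \<rho>))"
    then have ij: "i < k" "j < k" using apply_op_carrier[of Ls k n "apply_op n Ks \<rho>"] Lc by auto
    have "apply_op k (op_comp Ls Ks) \<rho> $$ (i,j) = (\<Sum>M\<leftarrow>op_comp Ls Ks. (M * \<rho> * adj M) $$ (i,j))"
      by (rule apply_op_index[OF Mc ij])
    also have "\<dots> = (\<Sum>K\<leftarrow>Ks. \<Sum>L\<leftarrow>Ls. ((L * K) * \<rho> * adj (L * K)) $$ (i,j))"
      unfolding op_comp_def by (rule sum_list_product)
    also have "\<dots> = (\<Sum>L\<leftarrow>Ls. \<Sum>K\<leftarrow>Ks. ((L * K) * \<rho> * adj (L * K)) $$ (i,j))"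
      by (rule sum_list_swap)
    also have "\<dots> = (\<Sum>L\<leftarrow>Ls. (L * apply_op n Ks \<rho> * adj L) $$ (i,j))"
    proof (rule sum_list_cong)
      fix L assume L: "L \<in> set Ls"
      have "((L * K) * \<rho> * adj (L * K)) $$ (i,j) = (\<Sum>u<n. \<Sum>v<n. L $$ (i,u) * (K * \<rho> * adj K) $$ (u,v) * adj L $$ (v,j))"
        if K: "K \<in> set Ks" for K
      proof -
        note c = Lc[OF L] Kc[OF K]
        have "(L * K) * \<rho> * adj (L * K) = L * (K * \<rho> * adj K) * adj L"
          unfolding adj_mult[OF c] by (rule mult_mat_assoc4) (use c r in auto)
        then show ?thesis using c r ij by (simp only:, intro mult3_index) auto
      qed
      then have "(\<Sum>K\<leftarrow>Ks. ((L * K) * \<rho> * adj (L * K)) $$ (i,j))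
         = (\<Sum>K\<leftarrow>Ks. \<Sum>u<n. \<Sum>v<n. L $$ (i,u) * (K * \<rho> * adj K) $$ (u,v) * adj L $$ (v,j))"
        by (rule sum_list_cong)
      also have "\<dots> = (\<Sum>u<n. \<Sum>v<n. L $$ (i,u) * (\<Sum>K\<leftarrow>Ks. (K * \<rho> * adj K) $$ (u,v)) * adj L $$ (v,j))"
        by (simp add: sum_list_sum sum_list_const_mult sum_list_mult_const del: index_mult_mat(1) index_adj)
      also have "\<dots> = (\<Sum>u<n. \<Sum>v<n. L $$ (i,u) * apply_op n Ks \<rho> $$ (u,v) * adj L $$ (v,j))"
        by (intro sum.cong refl) (simp add: apply_op_index[OF Kc] del: index_mult_mat(1) index_adj)
      also have "\<dots> = (L * apply_op n Ks \<rho> * adj L) $$ (i,j)"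
        using Lc[OF L] Ac ij by (intro mult3_index[symmetric]) auto
      finally show "(\<Sum>K\<leftarrow>Ks. ((L * K) * \<rho> * adj (L * K)) $$ (i,j)) = (L * apply_op n Ks \<rho> * adj L) $$ (i,j)" .
    qed
    also have "\<dots> = apply_op k Ls (apply_op n Ks \<rho>) $$ (i,j)"
      by (rule apply_op_index[OF Lc ij, symmetric])
    finally show "apply_op k (op_comp Ls Ks) \<rho> $$ (i,j) = apply_op k Ls (apply_op n Ks \<rho>) $$ (i,j)" .
  qed (use apply_op_carrier[OF Mc, of "op_comp Ls Ks" \<rho>] apply_op_carrier[OF Lc, of Ls "apply_op n Ks \<rho>"] in auto)
qed

lemma incoherent_op_kron:
  assumes K: "incoherent_op m n Ks" and L: "incoherent_op k l Ls"
  shows "incoherent_op (m * k) (n * l) (op_kron Ks Ls)"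
proof (rule incoherent_opI)
  note Kc = incoherent_op_carrier[OF K] and Lc = incoherent_op_carrier[OF L]
  show "incoherent_kraus_op (m * k) (n * l) M" if "M \<in> set (op_kron Ks Ls)" for M
    using that L K unfolding set_op_kron incoherent_op_def by (auto intro: incoherent_kraus_op_kron)
  fix i j assume ij: "i < m * k" "j < m * k"
  note dm = div_mod_less[OF ij(1)] div_mod_less[OF ij(2)]
  have "(\<Sum>M\<leftarrow>op_kron Ks Ls. (adj M * M) $$ (i,j)) = (\<Sum>K\<leftarrow>Ks. \<Sum>L\<leftarrow>Ls. (adj (kron K L) * kron K L) $$ (i,j))"
    unfolding op_kron_def by (rule sum_list_product)
  also have "\<dots> = (\<Sum>K\<leftarrow>Ks. \<Sum>L\<leftarrow>Ls. (adj K * K) $$ (i div k, j div k) * (adj L * L) $$ (i mod k, j mod k))"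
  proof (intro sum_list_cong)
    fix K L assume "K \<in> set Ks" "L \<in> set Ls"
    note c = Kc[OF this(1)] Lc[OF this(2)]
    have "adj (kron K L) * kron K L = kron (adj K * K) (adj L * L)"
      unfolding adj_kron by (rule kron_mult) (use c in auto)
    then show "(adj (kron K L) * kron K L) $$ (i,j) = (adj K * K) $$ (i div k, j div k) * (adj L * L) $$ (i mod k, j mod k)"
      using c ij by (simp only:, intro kron_index) auto
  qed
  also have "\<dots> = (\<Sum>K\<leftarrow>Ks. (adj K * K) $$ (i div k, j div k)) * (\<Sum>L\<leftarrow>Ls. (adj L * L) $$ (i mod k, j mod k))"
    by (simp add: sum_list_const_mult sum_list_mult_const del: index_mult_mat(1))
  also have "\<dots> = kron (1\<^sub>m m) (1\<^sub>m k) $$ (i,j)"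
    using ij dm by (simp only: incoherent_op_complete[OF K] incoherent_op_complete[OF L], intro kron_index[symmetric]) auto
  finally show "(\<Sum>M\<leftarrow>op_kron Ks Ls. (adj M * M) $$ (i,j)) = 1\<^sub>m (m * k) $$ (i,j)" by simp
qed

lemma apply_op_kron:
  assumes Kc: "\<And>K. K \<in> set Ks \<Longrightarrow> K \<in> carrier_mat n m" and Lc: "\<And>L. L \<in> set Ls \<Longrightarrow> L \<in> carrier_mat l k"
    and r: "\<rho> \<in> carrier_mat m m" and s: "\<sigma> \<in> carrier_mat k k"
  shows "apply_op (n * l) (op_kron Ks Ls) (kron \<rho> \<sigma>) = kron (apply_op n Ks \<rho>) (apply_op l Ls \<sigma>)"
proof -
  have Mc: "M \<in> carrier_mat (n * l) (m * k)" if "M \<in> set (op_kron Ks Ls)" for M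
    using that Lc Kc unfolding set_op_kron by (auto intro!: kron_carrier)
  have Ac: "apply_op n Ks \<rho> \<in> carrier_mat n n" "apply_op l Ls \<sigma> \<in> carrier_mat l l"
    using apply_op_carrier[OF Kc] apply_op_carrier[OF Lc] by auto
  show ?thesis
  proof (rule eq_matI)
    fix i j assume "i < dim_row (kron (apply_op n Ks \<rho>) (apply_op l Ls \<sigma>))" "j < dim_col (kron (apply_op n Ks \<rho>) (apply_op l Ls \<sigma>))"
    then have ij: "i < n * l" "j < n * l" using Ac by auto
    note dm = div_mod_less[OF ij(1)] div_mod_less[OF ij(2)]
    have "apply_op (n * l) (op_kron Ks Ls) (kron \<rho> \<sigma>) $$ (i,j) = (\<Sum>M\<leftarrow>op_kron Ks Ls. (M * kron \<rho> \<sigma> * adj M) $$ (i,j))"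
      by (rule apply_op_index[OF Mc ij])
    also have "\<dots> = (\<Sum>K\<leftarrow>Ks. \<Sum>L\<leftarrow>Ls. (kron K L * kron \<rho> \<sigma> * adj (kron K L)) $$ (i,j))"
      unfolding op_kron_def by (rule sum_list_product)
    also have "\<dots> = (\<Sum>K\<leftarrow>Ks. \<Sum>L\<leftarrow>Ls. (K * \<rho> * adj K) $$ (i div l, j div l) * (L * \<sigma> * adj L) $$ (i mod l, j mod l))"
    proof (intro sum_list_cong)
      fix K L assume "K \<in> set Ks" "L \<in> set Ls"
      note c = Kc[OF this(1)] Lc[OF this(2)]
      have "kron K L * kron \<rho> \<sigma> * adj (kron K L) = kron (K * \<rho> * adj K) (L * \<sigma> * adj L)"
        unfolding adj_kron kron_mult[OF c r s] by (rule kron_mult) (use c r s in auto)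
      then show "(kron K L * kron \<rho> \<sigma> * adj (kron K L)) $$ (i,j) = (K * \<rho> * adj K) $$ (i div l, j div l) * (L * \<sigma> * adj L) $$ (i mod l, j mod l)"
        using c r s ij by (simp only:, intro kron_index) auto
    qed
    also have "\<dots> = (\<Sum>K\<leftarrow>Ks. (K * \<rho> * adj K) $$ (i div l, j div l)) * (\<Sum>L\<leftarrow>Ls. (L * \<sigma> * adj L) $$ (i mod l, j mod l))"
      by (simp add: sum_list_const_mult sum_list_mult_const del: index_mult_mat(1))
    also have "\<dots> = apply_op n Ks \<rho> $$ (i div l, j div l) * apply_op l Ls \<sigma> $$ (i mod l, j mod l)"
      using apply_op_index[OF Kc dm(1,3), where \<rho>=\<rho>] apply_op_index[OF Lc dm(2,4), where \<rho>=\<sigma>] by simp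
    also have "\<dots> = kron (apply_op n Ks \<rho>) (apply_op l Ls \<sigma>) $$ (i,j)"
      by (rule kron_index[OF Ac ij, symmetric])
    finally show "apply_op (n * l) (op_kron Ks Ls) (kron \<rho> \<sigma>) $$ (i,j) = kron (apply_op n Ks \<rho>) (apply_op l Ls \<sigma>) $$ (i,j)" .
  qed (use apply_op_carrier[OF Mc, of "op_kron Ks Ls" "kron \<rho> \<sigma>"] Ac in auto)
qed

lemma incoherent_op_one: "incoherent_op n n [1\<^sub>m n]"
  by (auto simp: incoherent_op_def incoherent_kraus_op_def)

lemma incoherent_op_pow: "incoherent_op m n Ks \<Longrightarrow> incoherent_op (m ^ k) (n ^ k) (op_pow k Ks)"
  by (induction k) (use incoherent_op_one[of 1] in \<open>auto intro: incoherent_op_kron\<close>)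

lemma apply_op_pow:
  assumes K: "incoherent_op m n Ks" and r: "\<rho> \<in> carrier_mat m m"
  shows "apply_op (n ^ k) (op_pow k Ks) (tpow k \<rho>) = tpow k (apply_op n Ks \<rho>)"
proof (induction k)
  case 0
  show ?case by (simp add: apply_op_def)
next
  case (Suc k)
  show ?case
    using apply_op_kron[OF incoherent_op_carrier[OF K] incoherent_op_carrier[OF incoherent_op_pow[OF K, of k]] r tpow_carrier[OF r, of k]]
    by (simp add: Suc)
qed

section \<open>Preparation of diagonal states\<close>

lemma kron_rdiag: "kron (rdiag m p) (rdiag n q) = rdiag (m * n) (\<lambda>i. p (i div n) * q (i mod n))"
proof (rule eq_matI)
  fix i j assume "i < dim_row (rdiag (m * n) (\<lambda>i. p (i div n) * q (i mod n)))"
    "j < dim_col (rdiag (m * n) (\<lambda>i. p (i div n) * q (i mod n)))"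
  then have ij: "i < m * n" "j < m * n" by auto
  have "i = j \<longleftrightarrow> i div n = j div n \<and> i mod n = j mod n"
    by (metis div_mult_mod_eq)
  then show "kron (rdiag m p) (rdiag n q) $$ (i,j) = rdiag (m * n) (\<lambda>i. p (i div n) * q (i mod n)) $$ (i,j)"
    using ij div_mod_less[OF ij(1)] div_mod_less[OF ij(2)] by (auto simp: kron_def)
qed auto

lemma tpow_rdiag:
  assumes p: "\<And>i. i < d \<Longrightarrow> 0 \<le> p i" "(\<Sum>i<d. p i) = 1"
  shows "\<exists>P. tpow n (rdiag d p) = rdiag (d ^ n) P \<and> (\<forall>i<d^n. 0 \<le> P i) \<and> (\<Sum>i<d^n. P i) = 1"
proof (induction n)
  case 0
  show ?case by (rule exI[of _ "\<lambda>_. 1"]) (auto intro!: eq_matI)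
next
  case (Suc n)
  then obtain P where P: "tpow n (rdiag d p) = rdiag (d ^ n) P" "\<forall>i<d^n. 0 \<le> P i" "(\<Sum>i<d^n. P i) = 1"
    by blast
  let ?Q = "\<lambda>i. p (i div d ^ n) * P (i mod d ^ n)"
  have "(\<Sum>i<d * d^n. ?Q i) = (\<Sum>i<d. \<Sum>j<d^n. p i * P j)"
    by (rule sum_div_mod)
  also have "\<dots> = 1" by (simp add: sum_product[symmetric] p P(3))
  finally have "(\<Sum>i<d^Suc n. ?Q i) = 1" by simp
  moreover have "\<forall>i<d^Suc n. 0 \<le> ?Q i"
    using p(1) P(2) div_mod_less[of _ d "d ^ n"] by (auto intro!: mult_nonneg_nonneg)
  moreover have "tpow (Suc n) (rdiag d p) = rdiag (d^Suc n) ?Q"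
    by (simp add: P(1) kron_rdiag)
  ultimately show ?case by blast
qed

definition prepare_op :: "nat \<Rightarrow> (nat \<Rightarrow> real) \<Rightarrow> complex mat list" where
  "prepare_op N P = map (\<lambda>i. mat N 1 (\<lambda>(j,_). if j = i then complex_of_real (sqrt (P i)) else 0)) [0..<N]"

lemma prepare_op:
  assumes P: "\<And>i. i < N \<Longrightarrow> 0 \<le> P i" "(\<Sum>i<N. P i) = 1"
  shows "incoherent_op 1 N (prepare_op N P)" "apply_op N (prepare_op N P) (1\<^sub>m 1) = rdiag N P"
proof -
  define K where "K i = mat N 1 (\<lambda>(j,_::nat). if j = i then complex_of_real (sqrt (P i)) else 0)" for i
  have Kc: "K i \<in> carrier_mat N 1" for i by (simp add: K_def)
  have op: "prepare_op N P = map K [0..<N]" unfolding prepare_op_def K_def ..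
  have Kc': "M \<in> carrier_mat N 1" if "M \<in> set (prepare_op N P)" for M using that Kc unfolding op by auto
  show "incoherent_op 1 N (prepare_op N P)"
  proof (rule incoherent_opI)
    show "incoherent_kraus_op 1 N M" if M: "M \<in> set (prepare_op N P)" for M
    proof -
      obtain i where "i < N" "M = K i" using M unfolding op by auto
      then show ?thesis using Kc[of i] by (auto simp: incoherent_kraus_op_def K_def)
    qed
    fix x y :: nat assume xy: "x < 1" "y < 1"
    have "(adj (K i) * K i) $$ (x,y) = complex_of_real (P i)" if "i < N" for i
    proof -
      have "(adj (K i) * K i) $$ (x,y) = (\<Sum>l<N. adj (K i) $$ (x,l) * K i $$ (l,y))"
        by (rule mult_index[OF adj_carrier[OF Kc] Kc xy])
      also have "\<dots> = (\<Sum>l<N. if l = i then complex_of_real (sqrt (P i) * sqrt (P i)) else 0)"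
        using xy by (intro sum.cong) (auto simp: K_def simp flip: of_real_mult)
      finally show ?thesis using that P(1) by simp
    qed
    then have "(\<Sum>M\<leftarrow>prepare_op N P. (adj M * M) $$ (x,y)) = (\<Sum>i<N. complex_of_real (P i))"
      unfolding op by (simp add: o_def sum_list_upt del: index_mult_mat(1))
    then show "(\<Sum>M\<leftarrow>prepare_op N P. (adj M * M) $$ (x,y)) = 1\<^sub>m 1 $$ (x,y)"
      using xy P(2) by (simp flip: of_real_sum)
  qed
  show "apply_op N (prepare_op N P) (1\<^sub>m 1) = rdiag N P"
  proof (rule eq_matI)
    fix i j assume "i < dim_row (rdiag N P)" "j < dim_col (rdiag N P)"
    then have ij: "i < N" "j < N" by auto
    have "(K l * 1\<^sub>m 1 * adj (K l)) $$ (i,j) = (if l = i then rdiag N P $$ (i,j) else 0)" if "l < N" for l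
    proof -
      have "(K l * 1\<^sub>m 1 * adj (K l)) $$ (i,j) = (\<Sum>x<1. \<Sum>y<1. K l $$ (i,x) * 1\<^sub>m 1 $$ (x,y) * adj (K l) $$ (y,j))"
        by (rule mult3_index) (use Kc ij in auto)
      then show ?thesis using ij that P(1) by (auto simp: K_def simp flip: of_real_mult)
    qed
    then have "(\<Sum>M\<leftarrow>prepare_op N P. (M * 1\<^sub>m 1 * adj M) $$ (i,j)) = (\<Sum>l<N. if l = i then rdiag N P $$ (i,j) else 0)"
      unfolding op by (simp add: o_def sum_list_upt del: index_mult_mat(1))
    then show "apply_op N (prepare_op N P) (1\<^sub>m 1) $$ (i,j) = rdiag N P $$ (i,j)"
      using apply_op_index[OF Kc' ij, of "prepare_op N P" "1\<^sub>m 1"] ij by simp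
  qed (use apply_op_carrier[OF Kc', of "prepare_op N P" "1\<^sub>m 1"] in auto)
qed

lemma cost_achievable_diagonal:
  assumes st: "is_state d \<rho>" and diag: "\<And>i j. i < d \<Longrightarrow> j < d \<Longrightarrow> i \<noteq> j \<Longrightarrow> \<rho> $$ (i,j) = 0"
  shows "cost_achievable d \<rho> 0"
proof -
  have psd: "psd d \<rho>" and t: "tr \<rho> = 1" using st by (auto simp: is_state_def)
  note c = psdD(1)[OF psd]
  define p where "p i = Re (\<rho> $$ (i,i))" for i
  have real: "\<rho> $$ (i,i) = complex_of_real (p i)" if "i < d" for i
  proof -
    have "cnj (\<rho> $$ (i,i)) = \<rho> $$ (i,i)" using index_adj[of i \<rho> i] that c psdD(2)[OF psd] by simp
    then show ?thesis by (simp add: p_def complex_eq_iff)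
  qed
  have \<rho>: "\<rho> = rdiag d p" by (rule eq_matI) (use c diag real in auto)
  have nonneg: "0 \<le> p i" if i: "i < d" for i
  proof -
    have "conjugate (unit_vec d i) \<bullet> (\<rho> *\<^sub>v unit_vec d i)
        = (\<Sum>x<d. \<Sum>y<d. cnj (unit_vec d i $ x) * \<rho> $$ (x,y) * unit_vec d i $ y)"
      by (rule quad_form[OF c]) simp
    also have "\<dots> = (\<Sum>x<d. \<Sum>y<d. if y = i then (if x = i then \<rho> $$ (i,i) else 0) else 0)"
      by (intro sum.cong refl) (auto simp: unit_vec_def)
    also have "\<dots> = \<rho> $$ (i,i)" using i by simp
    finally show ?thesis using psdD(3)[OF psd, of "unit_vec d i"] by (simp add: p_def)
  qed
  have sum1: "(\<Sum>i<d. p i) = 1"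
    using t unfolding \<rho> tr_rdiag by (simp only: of_real_eq_1_iff)
  have "\<forall>n. \<exists>P. tpow n \<rho> = rdiag (d ^ n) P \<and> (\<forall>i<d^n. 0 \<le> P i) \<and> (\<Sum>i<d^n. P i) = 1"
    using tpow_rdiag[OF nonneg sum1] \<rho> by auto
  then obtain P where P: "\<And>n. tpow n \<rho> = rdiag (d ^ n) (P n)" "\<And>n i. i < d^n \<Longrightarrow> 0 \<le> P n i"
      "\<And>n. (\<Sum>i<d^n. P n i) = 1"
    by metis
  \<comment> \<open>At rate 0 the resource is \<open>tpow 0 Phi2\<close>, the 1 by 1 identity, so
    the input dimension is 1.\<close>
  have "incoherent_op 1 (d ^ n) (prepare_op (d ^ n) (P n))" for n
    by (rule prepare_op) (use P in auto)
  moreover have "fidelity (apply_op (d ^ n) (prepare_op (d ^ n) (P n)) (1\<^sub>m 1)) (tpow n \<rho>) = 1" for n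
  proof -
    have "apply_op (d ^ n) (prepare_op (d ^ n) (P n)) (1\<^sub>m 1) = rdiag (d ^ n) (P n)"
      by (rule prepare_op) (use P in auto)
    then show ?thesis using fidelity_rdiag_self[of "d ^ n" "P n"] P by simp
  qed
  ultimately show ?thesis
    unfolding cost_achievable_def by (auto intro!: exI[of _ "\<lambda>n. prepare_op (d ^ n) (P n)"])
qed

section \<open>Distillation from coherent states\<close>

lemma tpow_Phi2: "tpow k Phi2 = mat (2^k) (2^k) (\<lambda>_. 1 / 2^k)"
proof (induction k)
  case 0
  show ?case by (rule eq_matI) auto
next
  case (Suc k)
  show ?case unfolding tpow.simps Suc
    by (rule eq_matI) (auto simp: kron_def Phi2_def div_mod_less less_mult_imp_div_less)
qed

section \<open>Reduction to a dephased qubit\<close>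

definition dephased :: "real \<Rightarrow> complex mat" where
  "dephased a = mat 2 2 (\<lambda>(i,j). if i = j then 1/2 else complex_of_real a)"

text \<open>Writing \<open>\<rho>\<close> as a Gram matrix, the entry is an inner product of two
  columns and so at most the mean of their squared norms, which are diagonal entries with sum at
  most the trace. The bound ensures that \<open>1/2 - a\<close> is a probability.\<close>

lemma off_diagonal_le:
  assumes st: "is_state d \<rho>" and pq: "p < d" "q < d" "p \<noteq> q"
  shows "cmod (\<rho> $$ (p,q)) \<le> 1/2"
proof -
  have psd: "psd d \<rho>" and t: "tr \<rho> = 1" using st by (auto simp: is_state_def)
  note c = psdD(1)[OF psd]
  obtain C where C: "C \<in> carrier_mat d d" "adj C * C = \<rho>" using psd_factor[OF psd] .
  have e: "\<rho> $$ (x,y) = (\<Sum>l<d. cnj (C $$ (l,x)) * C $$ (l,y))" if "x < d" "y < d" for x y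
    unfolding C(2)[symmetric] using C(1) that by (subst mult_index[of _ d d _ d]) (auto intro!: sum.cong)
  have D: "Re (\<rho> $$ (x,x)) = (\<Sum>l<d. (cmod (C $$ (l,x)))\<^sup>2)" if "x < d" for x
    unfolding e[OF that that] Re_sum by (intro sum.cong refl) (simp add: cmod_power2[unfolded power2_eq_square] power2_eq_square)
  have D0: "0 \<le> Re (\<rho> $$ (x,x))" if "x < d" for x unfolding D[OF that] by (simp add: sum_nonneg)
  have "cmod (\<rho> $$ (p,q)) \<le> (\<Sum>l<d. cmod (C $$ (l,p)) * cmod (C $$ (l,q)))"
    unfolding e[OF pq(1,2)] by (rule order_trans[OF norm_sum]) (simp add: norm_mult)
  also have "\<dots> \<le> (\<Sum>l<d. ((cmod (C $$ (l,p)))\<^sup>2 + (cmod (C $$ (l,q)))\<^sup>2) / 2)"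
  proof (rule sum_mono)
    fix l
    show "cmod (C $$ (l,p)) * cmod (C $$ (l,q)) \<le> ((cmod (C $$ (l,p)))\<^sup>2 + (cmod (C $$ (l,q)))\<^sup>2) / 2"
      using sum_squares_bound[of "cmod (C $$ (l,p))" "cmod (C $$ (l,q))"] by simp
  qed
  also have "\<dots> = (\<Sum>x\<in>{p,q}. Re (\<rho> $$ (x,x))) / 2"
    using pq by (simp add: D sum.distrib add_divide_distrib sum_divide_distrib)
  also have "(\<Sum>x\<in>{p,q}. Re (\<rho> $$ (x,x))) \<le> (\<Sum>x<d. Re (\<rho> $$ (x,x)))"
    by (rule sum_mono2) (use pq D0 in auto)
  also have "(\<Sum>x<d. Re (\<rho> $$ (x,x))) = 1"
    using t c by (simp add: tr_def flip: Re_sum)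
  finally show ?thesis by simp
qed

text \<open>The Kraus operators with index \<open>i = p\<close> filter out the coherence between \<open>p\<close> and \<open>q\<close>, the
  others replace the remaining levels by a maximally mixed qubit; \<open>s\<close> is a random bit flip.\<close>
lemma dephased_from_coherent:
  assumes st: "is_state d \<rho>" and pq: "p < d" "q < d" "p \<noteq> q" and nz: "\<rho> $$ (p,q) \<noteq> 0"
  shows "\<exists>Ks. incoherent_op d 2 Ks \<and> apply_op 2 Ks \<rho> = dephased (cmod (\<rho> $$ (p,q)))"
proof -
  have psd: "psd d \<rho>" and t: "tr \<rho> = 1" using st by (auto simp: is_state_def)
  note c = psdD(1)[OF psd]
  define a where "a = \<rho> $$ (p,q)"
  \<comment> \<open>The phase that turns the entry \<open>a\<close> into its modulus; as the qubit
    entry has to be real and positive, it is attached to level \<open>p\<close> in the Kraus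
    operators.\<close>
  define u where "u = cnj a / complex_of_real (cmod a)"
  have ua: "u * a = complex_of_real (cmod a)"
    using nz unfolding u_def a_def[symmetric]
    by (simp add: complex_norm_square[symmetric] mult.commute power2_eq_square)
  have uu: "cnj u * u = 1"
    using nz unfolding u_def a_def[symmetric]
    by (simp add: complex_norm_square[symmetric] power2_eq_square)
  have qp: "\<rho> $$ (q,p) = cnj a"
    using index_adj[of q \<rho> p] pq c psdD(2)[OF psd] by (simp add: a_def)
  \<comment> \<open>For \<open>i = q\<close> the operator is zero, since \<open>q\<close> is treated
    together with \<open>p\<close>; the index can thus run over all levels.\<close>
  define g where "g i x = (if i = p then if x = p then u else if x = q then 1 else 0
     else if i = q then 0 else if x = i then 1 else 0)" for i x :: nat
  \<comment> \<open>\<open>p\<close> and \<open>q\<close> are sent to opposite bits, and averaging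
    over both assignments equalizes the two diagonal entries. The coherence survives this because,
    after the phase \<open>u\<close>, it is real and hence symmetric under the exchange.\<close>
  define b where "b s x = (if x = q then Suc 0 - s else s)" for s x :: nat
  define K where "K i s = mat 2 d (\<lambda>(j,x). if j = b s x then g i x / complex_of_real (sqrt 2) else 0)" for i s
  define Ks where "Ks = concat (map (\<lambda>i. map (K i) [0..<2]) [0..<d])"
  have Kc: "K i s \<in> carrier_mat 2 d" for i s by (simp add: K_def)
  have Ks: "M \<in> set Ks \<Longrightarrow> \<exists>i s. s < 2 \<and> M = K i s" for M
    unfolding Ks_def by fastforce
  have Kc': "M \<in> carrier_mat 2 d" if "M \<in> set Ks" for M using Ks[OF that] Kc by auto
  have half: "complex_of_real (sqrt 2) * complex_of_real (sqrt 2) = 2"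
    by (simp flip: of_real_mult)
  have b2: "b s x < 2" if "s < 2" for s x using that by (auto simp: b_def)
  have s2: "(\<Sum>s<2. F s) = F 0 + F (Suc 0)" for F :: "nat \<Rightarrow> complex" by (simp add: numeral_2_eq_2)
  have "incoherent_op d 2 Ks"
  proof (rule incoherent_opI)
    show "incoherent_kraus_op d 2 M" if MK: "M \<in> set Ks" for M
    proof -
      obtain i s where M: "s < 2" "M = K i s" using Ks[OF MK] by blast
      have "\<exists>j<2. \<forall>k<2. k \<noteq> j \<longrightarrow> K i s $$ (k, x) = 0" if "x < d" for x
        by (rule exI[of _ "b s x"]) (use that b2[OF M(1)] in \<open>auto simp: K_def\<close>)
      then show ?thesis unfolding incoherent_kraus_op_def M(2) using Kc by blast
    qed
    fix x y assume xy: "x < d" "y < d"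
    have "(adj (K i s) * K i s) $$ (x,y) = (if b s x = b s y then cnj (g i x) * g i y / 2 else 0)" if s: "s < 2" for i s
    proof -
      have "(adj (K i s) * K i s) $$ (x,y) = (\<Sum>l<2. adj (K i s) $$ (x,l) * K i s $$ (l,y))"
        by (rule mult_index) (use Kc xy in auto)
      also have "\<dots> = (\<Sum>l<2. if l = b s x then if b s x = b s y then cnj (g i x) * g i y / 2 else 0 else 0)"
        using xy half by (intro sum.cong) (auto simp: K_def)
      finally show ?thesis using b2[OF s] by simp
    qed
    then have "(\<Sum>M\<leftarrow>Ks. (adj M * M) $$ (x,y)) = (\<Sum>i<d. if x = q \<longleftrightarrow> y = q then cnj (g i x) * g i y else 0)"
      unfolding Ks_def sum_list_product sum_list_upt
      by (intro sum.cong refl) (auto simp: s2 b_def simp del: index_mult_mat(1))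
    also have "\<dots> = (\<Sum>i<d. if x = y then if x = p \<or> x = q then if i = p then 1 else 0 else if i = x then 1 else 0 else 0)"
      by (intro sum.cong refl) (use pq uu in \<open>auto simp: g_def\<close>)
    also have "\<dots> = 1\<^sub>m d $$ (x,y)" using xy pq by (cases "x = p"; cases "x = q") auto
    finally show "(\<Sum>M\<leftarrow>Ks. (adj M * M) $$ (x,y)) = 1\<^sub>m d $$ (x,y)" .
  qed
  moreover have "apply_op 2 Ks \<rho> = dephased (cmod a)"
  proof (rule eq_matI)
    fix j k assume "j < dim_row (dephased (cmod a))" "k < dim_col (dephased (cmod a))"
    then have jk: "j < 2" "k < 2" by (auto simp: dephased_def)
    define H where "H i x y = g i x * \<rho> $$ (x,y) * cnj (g i y) / 2" for i x y
    have "(K i s * \<rho> * adj (K i s)) $$ (j,k) = (\<Sum>x<d. \<Sum>y<d. if j = b s x \<and> k = b s y then H i x y else 0)"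
      if "s < 2" for i s
    proof -
      have "(K i s * \<rho> * adj (K i s)) $$ (j,k) = (\<Sum>x<d. \<Sum>y<d. K i s $$ (j,x) * \<rho> $$ (x,y) * adj (K i s) $$ (y,k))"
        by (rule mult3_index) (use Kc c jk in auto)
      also have "\<dots> = (\<Sum>x<d. \<Sum>y<d. if j = b s x \<and> k = b s y then H i x y else 0)"
        using jk by (intro sum.cong refl) (auto simp: K_def H_def half)
      finally show ?thesis .
    qed
    then have "(\<Sum>M\<leftarrow>Ks. (M * \<rho> * adj M) $$ (j,k))
        = (\<Sum>i<d. \<Sum>s<2. \<Sum>x<d. \<Sum>y<d. if j = b s x \<and> k = b s y then H i x y else 0)"
      unfolding Ks_def sum_list_product sum_list_upt by (intro sum.cong refl) auto
    also have "\<dots> = (\<Sum>i<d. if i = q then 0 else if i = p then (if j = k then (\<rho> $$ (p,p) + \<rho> $$ (q,q)) / 2 else complex_of_real (cmod a))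
       else if j = k then \<rho> $$ (i,i) / 2 else 0)"
    proof (rule sum.cong[OF refl])
      fix i assume "i \<in> {..<d}"
      then have i: "i < d" by simp
      consider "i = q" | "i = p" | "i \<noteq> p" "i \<noteq> q" by blast
      then show "(\<Sum>s<2. \<Sum>x<d. \<Sum>y<d. if j = b s x \<and> k = b s y then H i x y else 0) =
        (if i = q then 0 else if i = p then (if j = k then (\<rho> $$ (p,p) + \<rho> $$ (q,q)) / 2 else complex_of_real (cmod a))
         else if j = k then \<rho> $$ (i,i) / 2 else 0)"
      proof cases
        case 1
        then have "H i x y = 0" for x y using pq by (simp add: H_def g_def)
        then show ?thesis using 1 by simp
      next
        case 2
        have *: "(\<Sum>x<d. \<Sum>y<d. if j = b s x \<and> k = b s y then H i x y else 0)
          = (\<Sum>x\<in>{p,q}. \<Sum>y\<in>{p,q}. if j = b s x \<and> k = b s y then H i x y else 0)" for s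
        proof -
          have "(\<Sum>x<d. \<Sum>y<d. if j = b s x \<and> k = b s y then H i x y else 0)
            = (\<Sum>x<d. \<Sum>y\<in>{p,q}. if j = b s x \<and> k = b s y then H i x y else 0)"
            using pq 2 by (intro sum.cong refl sum.mono_neutral_right) (auto simp: H_def g_def)
          also have "\<dots> = (\<Sum>x\<in>{p,q}. \<Sum>y\<in>{p,q}. if j = b s x \<and> k = b s y then H i x y else 0)"
            using pq 2 by (intro sum.mono_neutral_right) (auto simp: H_def g_def intro!: sum.neutral)
          finally show ?thesis .
        qed
        have uu': "u * X * cnj u = X" for X :: complex
          using uu by (metis mult.assoc mult.commute mult.left_neutral)
        have ua': "cnj a * cnj u = complex_of_real (cmod a)"
          using arg_cong[OF ua, of cnj] by (simp add: mult.commute)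
        have Hs: "H p p p = \<rho> $$ (p,p) / 2" "H p q q = \<rho> $$ (q,q) / 2"
          "H p p q = complex_of_real (cmod a) / 2" "H p q p = complex_of_real (cmod a) / 2"
          using pq ua ua' uu' by (auto simp: H_def g_def qp a_def[symmetric])
        then show ?thesis
          using 2 pq jk unfolding s2 * by (auto simp: b_def Hs less_2_cases_iff add_divide_distrib)
      next
        case 3
        have "(\<Sum>x<d. \<Sum>y<d. if j = b s x \<and> k = b s y then H i x y else 0)
           = (\<Sum>x<d. \<Sum>y<d. if y = i then if x = i then if j = s \<and> k = s then \<rho> $$ (i,i) / 2 else 0 else 0 else 0)" for s
          using 3 by (intro sum.cong refl) (auto simp: b_def H_def g_def)
        then have "(\<Sum>x<d. \<Sum>y<d. if j = b s x \<and> k = b s y then H i x y else 0) = (if j = s \<and> k = s then \<rho> $$ (i,i) / 2 else 0)" for s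
          using i by simp
        then show ?thesis unfolding s2 using 3 jk by (auto simp: less_2_cases_iff)
      qed
    qed
    also have "\<dots> = dephased (cmod a) $$ (j,k)"
    proof (cases "j = k")
      case True
      \<comment> \<open>The term \<open>i = p\<close> contains the population of \<open>q\<close>;
        moving it back to \<open>i = q\<close> restores the trace.\<close>
      have "(\<Sum>i<d. if i = q then 0 else if i = p then (\<rho> $$ (p,p) + \<rho> $$ (q,q)) / 2 else \<rho> $$ (i,i) / 2)
         = (\<Sum>i<d. \<rho> $$ (i,i) / 2 + (if i = p then \<rho> $$ (q,q) / 2 else 0) - (if i = q then \<rho> $$ (q,q) / 2 else 0))"
        using pq by (intro sum.cong refl) (auto simp: add_divide_distrib)
      also have "\<dots> = tr \<rho> / 2"
        using pq c by (simp add: sum.distrib sum_subtractf tr_def sum_divide_distrib)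
      finally show ?thesis using jk(2) unfolding True by (simp add: t dephased_def cong: if_cong)
    next
      case False
      have "(\<Sum>i<d. if i = q then 0 else if i = p then complex_of_real (cmod a) else 0) = (\<Sum>i<d. if i = p then complex_of_real (cmod a) else 0)"
        using pq by (intro sum.cong refl) auto
      then show ?thesis using False jk pq by (simp add: dephased_def cong: if_cong)
    qed
    finally show "apply_op 2 Ks \<rho> $$ (j,k) = dephased (cmod a) $$ (j,k)"
      using apply_op_index[OF Kc' jk, of Ks \<rho>] by simp
  qed (use apply_op_carrier[OF Kc', of Ks \<rho>] in \<open>auto simp: dephased_def\<close>)
  ultimately show ?thesis unfolding a_def by blast
qed

text \<open>Dependence on \<open>xor x y\<close> alone makes the tensor power a convolution operator
  on bit strings, which the characters diagonalize.\<close>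

lemma tpow_dephased_index:
  assumes "x < 2 ^ n" "y < 2 ^ n"
  shows "tpow n (dephased a) $$ (x,y) = complex_of_real (\<Prod>i<n. if bit (xor x y) i then a else 1/2)"
  using assms
proof (induction n arbitrary: x y)
  case 0
  then show ?case by simp
next
  case (Suc n)
  have xy: "x < 2 * 2 ^ n" "y < 2 * 2 ^ n" using Suc.prems by auto
  note dm = div_mod_less[OF xy(1)] div_mod_less[OF xy(2)]
  have c: "dephased a \<in> carrier_mat 2 2" by (simp add: dephased_def)
  have c': "tpow n (dephased a) \<in> carrier_mat (2 ^ n) (2 ^ n)" by (rule tpow_carrier[OF c])
  \<comment> \<open>In the lexicographic product basis the leading tensor factor is the most
    significant bit of the index.\<close>
  have top: "bit z n \<longleftrightarrow> z div 2 ^ n = 1" if "z div 2 ^ n < 2" for z :: nat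
    using that by (auto simp: bit_iff_odd less_2_cases_iff)
  have low: "bit (z mod 2 ^ n) i \<longleftrightarrow> bit z i" if "i < n" for z i :: nat
    using that by (simp add: bit_take_bit_iff flip: take_bit_eq_mod)
  have "tpow (Suc n) (dephased a) $$ (x,y)
     = dephased a $$ (x div 2^n, y div 2^n) * tpow n (dephased a) $$ (x mod 2^n, y mod 2^n)"
    unfolding tpow.simps by (rule kron_index[OF c c' xy])
  also have "dephased a $$ (x div 2^n, y div 2^n) = complex_of_real (if bit (xor x y) n then a else 1/2)"
    using dm top[of x] top[of y] by (auto simp: dephased_def bit_xor_iff less_2_cases_iff)
  also have "tpow n (dephased a) $$ (x mod 2^n, y mod 2^n) = complex_of_real (\<Prod>i<n. if bit (xor x y) i then a else 1/2)"
    unfolding Suc.IH[OF dm(2,4)]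
    by (intro arg_cong[of _ _ complex_of_real] prod.cong refl) (simp add: bit_xor_iff low)
  finally show ?case by (simp add: mult.commute)
qed

lemma dephased_psd:
  assumes "0 \<le> a" "a \<le> 1/2"
  shows "psd 2 (dephased a)"
proof -
  \<comment> \<open>The eigenvalues are \<open>1/2 + a\<close> on \<open>(1,1)/sqrt 2\<close> and
    \<open>1/2 - a\<close> on \<open>(1,-1)/sqrt 2\<close>; the rows of \<open>C\<close> are these
    vectors scaled by the roots of the eigenvalues.\<close>
  define s where "s = sqrt (1/2 + a) / sqrt 2"
  define t where "t = sqrt (1/2 - a) / sqrt 2"
  define C where "C = mat 2 2 (\<lambda>(i,j). if i = 0 then complex_of_real s else if j = 0 then complex_of_real t else - complex_of_real t)"
  have st: "s * s = (1/2 + a) / 2" "t * t = (1/2 - a) / 2"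
    using assms by (simp_all add: s_def t_def)
  have Cc: "C \<in> carrier_mat 2 2" by (simp add: C_def)
  have "adj C * C = dephased a"
  proof (rule eq_matI)
    fix i j assume "i < dim_row (dephased a)" "j < dim_col (dephased a)"
    then have ij: "i < 2" "j < 2" by (auto simp: dephased_def)
    have "(adj C * C) $$ (i,j) = (\<Sum>l<2. adj C $$ (i,l) * C $$ (l,j))"
      by (rule mult_index[OF adj_carrier[OF Cc] Cc ij])
    also have "\<dots> = complex_of_real (s * s) + (if i = j then complex_of_real (t * t) else - complex_of_real (t * t))"
      using ij by (auto simp: numeral_2_eq_2 less_Suc_eq C_def)
    also have "\<dots> = dephased a $$ (i,j)"
      using ij unfolding st by (auto simp: dephased_def field_simps simp flip: of_real_add of_real_diff)
    finally show "(adj C * C) $$ (i,j) = dephased a $$ (i,j)" .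
  qed (auto simp: C_def dephased_def)
  then show ?thesis using psd_gram[OF Cc] by simp
qed

section \<open>Phase errors and the code operation\<close>

text \<open>Independent phase flips, and at the same time the eigenvalue of the n-fold dephased
  qubit on the character of \<open>e\<close>.\<close>

definition error_prob :: "real \<Rightarrow> nat \<Rightarrow> nat \<Rightarrow> real" where
  "error_prob a n e = (\<Prod>i<n. if bit e i then 1/2 - a else 1/2 + a)"

lemma error_prob_nonneg: "0 \<le> a \<Longrightarrow> a \<le> 1/2 \<Longrightarrow> 0 \<le> error_prob a n e"
  unfolding error_prob_def by (rule prod_nonneg) auto

lemma sum_error_prob: "(\<Sum>e<2^n. error_prob a n e) = 1"
  using sum_bits_prod[where n=n and h="\<lambda>_ b. if b then 1/2 - a else 1/2 + a"]
  by (simp add: error_prob_def)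

lemma sum_sqrt_error_prob:
  "(\<Sum>e<2^n. sqrt (error_prob a n e)) = (sqrt (1/2 + a) + sqrt (1/2 - a)) ^ n"
proof -
  have "sqrt (error_prob a n e) = (\<Prod>i<n. if bit e i then sqrt (1/2 - a) else sqrt (1/2 + a))" for e
    unfolding error_prob_def by (induction n) (auto simp: real_sqrt_mult)
  then show ?thesis
    using sum_bits_prod[where n=n and h="\<lambda>_ b. if b then sqrt (1/2 - a) else sqrt (1/2 + a)"] by simp
qed

text \<open>In terms of \<open>z = xor y x\<close> the summand no longer involves \<open>x\<close>,
  so the double sum is \<open>2^n\<close> times the Walsh transform of a product function, and this
  transform factorizes over the bits. The characters are unnormalized, whence the factor
  \<open>2^n\<close>.\<close>

lemma character_expectation:
  assumes e: "e < 2 ^ n"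
  shows "(\<Sum>x<2^n. \<Sum>y<2^n. complex_of_real (character n e x) * tpow n (dephased a) $$ (x,y) * complex_of_real (character n e y))
     = complex_of_real (2 ^ n * error_prob a n e)"
proof -
  define g where "g z = (\<Prod>i<n. if bit z i then a else 1/2)" for z :: nat
  have "(\<Sum>x<2^n. \<Sum>y<2^n. complex_of_real (character n e x) * tpow n (dephased a) $$ (x,y) * complex_of_real (character n e y))
     = (\<Sum>x<2^n. \<Sum>y<2^n. complex_of_real (character n e (xor y x) * g (xor y x)))"
    by (intro sum.cong refl)
       (simp add: tpow_dephased_index g_def character_xor_right xor.commute[of _ "_::nat"] mult_ac)
  also have "\<dots> = (\<Sum>x<(2::nat)^n. \<Sum>z<2^n. complex_of_real (character n e z * g z))"
    by (rule sum.cong[OF refl], rule sum_xor_reindex[where F="\<lambda>z. complex_of_real (character n e z * g z)"]) simp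
  also have "\<dots> = complex_of_real (2 ^ n * (\<Sum>z<2^n. character n e z * g z))"
    by simp
  also have "(\<Sum>z<2^n. character n e z * g z) = (\<Sum>z<2^n. \<Prod>i<n. if bit (z::nat) i then (if bit e i then - a else a) else 1/2)"
    unfolding character_def g_def prod.distrib[symmetric] by (intro sum.cong refl prod.cong) auto
  also have "\<dots> = (\<Prod>i<n. 1/2 + (if bit e i then - a else a))"
    using sum_bits_prod[where n=n and h="\<lambda>i b. if b then (if bit e i then - a else a) else 1/2"] by simp
  also have "\<dots> = error_prob a n e"
    unfolding error_prob_def by (rule prod.cong) auto
  finally show ?thesis .
qed

text \<open>The outcome \<open>l\<close> is a syndrome, measured in the character basis within the fibres of \<open>f\<close>;
  \<open>D l\<close> is the phase error that is corrected on seeing it.\<close>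
definition code_op :: "nat \<Rightarrow> nat \<Rightarrow> (nat \<Rightarrow> nat) \<Rightarrow> (nat \<Rightarrow> nat) \<Rightarrow> complex mat list" where
  "code_op n k f D = map (\<lambda>l. mat (2^k) (2^n)
     (\<lambda>(j,x). if j = f x then complex_of_real (character n (D l) x / sqrt (2^n)) else 0)) [0..<2^n]"

text \<open>\<open>l\<close> and \<open>D l\<close> differ by a word of \<open>W\<close>, so their
  characters give the same relative phase to any two points of one fibre of \<open>f\<close>.
  Completeness thus reduces to the orthogonality of all \<open>2^n\<close> characters, although
  \<open>D\<close> repeats the same correction for many outcomes.\<close>

lemma code_op_incoherent:
  assumes f: "\<And>x. f x < 2 ^ k"
    and fW: "\<And>x y w. f x = f y \<Longrightarrow> w \<in> W \<Longrightarrow> character n w (xor x y) = 1"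
    and D: "\<And>l. xor l (D l) \<in> W"
  shows "incoherent_op (2^n) (2^k) (code_op n k f D)"
proof (rule incoherent_opI)
  define K where "K l = mat (2^k) (2^n)
     (\<lambda>(j,x). if j = f x then complex_of_real (character n (D l) x / sqrt (2^n)) else 0)" for l
  have op: "code_op n k f D = map K [0..<2^n]" unfolding code_op_def K_def ..
  have Kc: "K l \<in> carrier_mat (2^k) (2^n)" for l by (simp add: K_def)
  show "incoherent_kraus_op (2^n) (2^k) M" if MK: "M \<in> set (code_op n k f D)" for M
  proof -
    obtain l where M: "M = K l" using MK unfolding op by auto
    have "\<exists>j<2^k. \<forall>h<2^k. h \<noteq> j \<longrightarrow> K l $$ (h, x) = 0" if "x < 2^n" for x
      by (rule exI[of _ "f x"]) (use that f in \<open>auto simp: K_def\<close>)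
    then show ?thesis unfolding incoherent_kraus_op_def M using Kc by blast
  qed
  fix x y :: nat assume xy: "x < 2^n" "y < 2^n"
  have "(adj (K l) * K l) $$ (x,y) = complex_of_real (if f x = f y then character n l (xor x y) / 2^n else 0)" for l
  proof -
    have "(adj (K l) * K l) $$ (x,y) = (\<Sum>j<2^k. adj (K l) $$ (x,j) * K l $$ (j,y))"
      by (rule mult_index[OF adj_carrier[OF Kc] Kc xy])
    also have "\<dots> = (\<Sum>j<2^k. if j = f x then complex_of_real (if f x = f y then character n (D l) (xor x y) / 2^n else 0) else 0)"
      using xy by (intro sum.cong) (auto simp: K_def character_xor_right simp flip: of_real_mult)
    also have "\<dots> = complex_of_real (if f x = f y then character n (D l) (xor x y) / 2^n else 0)"
      using f[of x] by simp
    also have "\<dots> = complex_of_real (if f x = f y then character n l (xor x y) / 2^n else 0)"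
    proof (cases "f x = f y")
      case True
      have "character n l (xor x y) * character n (D l) (xor x y) = 1"
        using fW[OF True D[of l]] by (simp add: character_xor_left)
      then show ?thesis
        using character_cases[of n l "xor x y"] by auto
    qed simp
    finally show ?thesis .
  qed
  then have "(\<Sum>M\<leftarrow>code_op n k f D. (adj M * M) $$ (x,y))
      = complex_of_real (\<Sum>l<2^n. if f x = f y then character n l (xor x y) / 2^n else 0)"
    unfolding op by (simp add: o_def sum_list_upt del: index_mult_mat(1))
  also have "(\<Sum>l<2^n. if f x = f y then character n l (xor x y) / 2^n else 0) = (if x = y then 1 else 0)"
  proof (cases "f x = f y")
    case True
    have "xor x y = 0 \<longleftrightarrow> x = y" by (metis xor_right_cancel xor_self_eq xor.left_neutral)
    then show ?thesis
      using True sum_character[OF xor_less_power2[OF xy]] by (simp flip: sum_divide_distrib)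
  qed auto
  finally show "(\<Sum>M\<leftarrow>code_op n k f D. (adj M * M) $$ (x,y)) = 1\<^sub>m (2^n) $$ (x,y)"
    using xy by simp
qed

text \<open>The target is a uniform superposition, so the overlap with it adds up all rows of a
  Kraus operator. That erases \<open>f\<close> and leaves the normalized character of
  \<open>D l\<close>, whose expectation is the probability of the error \<open>D l\<close>. The
  divisor \<open>2^k\<close> is the normalization of the target.\<close>

lemma code_op_fidelity:
  assumes f: "\<And>x. f x < 2 ^ k" and D: "\<And>l. l < 2^n \<Longrightarrow> D l < 2^n" and a: "0 \<le> a" "a \<le> 1/2"
  shows "fidelity (apply_op (2^k) (code_op n k f D) (tpow n (dephased a))) (tpow k Phi2)
    = complex_of_real (sqrt ((\<Sum>l<2^n. error_prob a n (D l)) / 2^k))"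
proof -
  define K where "K l = mat (2^k) (2^n)
     (\<lambda>(j,x). if j = f x then complex_of_real (character n (D l) x / sqrt (2^n)) else 0)" for l
  have op: "code_op n k f D = map K [0..<2^n]" unfolding code_op_def K_def ..
  have Kc: "K l \<in> carrier_mat (2^k) (2^n)" for l by (simp add: K_def)
  have Kc': "M \<in> carrier_mat (2^k) (2^n)" if "M \<in> set (code_op n k f D)" for M using that Kc unfolding op by auto
  define \<tau> where "\<tau> = tpow n (dephased a)"
  have \<tau>: "psd (2^n) \<tau>" unfolding \<tau>_def by (rule psd_tpow[OF dephased_psd[OF a]])
  define \<omega> where "\<omega> = apply_op (2^k) (code_op n k f D) \<tau>"
  have \<omega>: "psd (2^k) \<omega>" unfolding \<omega>_def by (rule apply_op_psd[OF Kc' \<tau>])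
  define v where "v = vec (2^k) (\<lambda>_. complex_of_real (1 / sqrt (2^k)))"
  have v: "v \<in> carrier_vec (2^k)" by (simp add: v_def)
  have Phi: "tpow k Phi2 = mat (2^k) (2^k) (\<lambda>(i,j). v $ i * cnj (v $ j))"
    unfolding tpow_Phi2 by (rule eq_matI) (auto simp: v_def simp flip: of_real_mult)
  have entry: "\<omega> $$ (i,j) = (\<Sum>l<2^n. \<Sum>x<2^n. \<Sum>y<2^n. K l $$ (i,x) * \<tau> $$ (x,y) * cnj (K l $$ (j,y)))"
    if "i < 2^k" "j < 2^k" for i j
  proof -
    have "\<omega> $$ (i,j) = (\<Sum>l<2^n. (K l * \<tau> * adj (K l)) $$ (i,j))"
      using apply_op_index[OF Kc' that, of "code_op n k f D" \<tau>]
      by (simp add: \<omega>_def op o_def sum_list_upt del: index_mult_mat(1))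
    also have "\<dots> = (\<Sum>l<2^n. \<Sum>x<2^n. \<Sum>y<2^n. K l $$ (i,x) * \<tau> $$ (x,y) * adj (K l) $$ (y,j))"
      by (intro sum.cong refl mult3_index[OF Kc psdD(1)[OF \<tau>] adj_carrier[OF Kc] that])
    also have "\<dots> = (\<Sum>l<2^n. \<Sum>x<2^n. \<Sum>y<2^n. K l $$ (i,x) * \<tau> $$ (x,y) * cnj (K l $$ (j,y)))"
      by (intro sum.cong refl) (use that Kc in \<open>auto simp: K_def\<close>)
    finally show ?thesis .
  qed
  have colsum: "(\<Sum>i<2^k. K l $$ (i,x)) = complex_of_real (character n (D l) x / sqrt (2^n))" if "x < 2^n" for l x
  proof -
    have "(\<Sum>i<2^k. K l $$ (i,x)) = (\<Sum>i<2^k. if i = f x then complex_of_real (character n (D l) x / sqrt (2^n)) else 0)"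
      by (rule sum.cong) (use that in \<open>auto simp: K_def\<close>)
    then show ?thesis using f[of x] by simp
  qed
  have "conjugate v \<bullet> (\<omega> *\<^sub>v v) = (\<Sum>i<2^k. \<Sum>j<2^k. cnj (v $ i) * \<omega> $$ (i,j) * v $ j)"
    by (rule quad_form[OF psdD(1)[OF \<omega>] v])
  also have "\<dots> = (\<Sum>i<2^k. \<Sum>j<2^k. \<omega> $$ (i,j) / 2^k)"
    by (intro sum.cong refl) (auto simp: v_def simp flip: of_real_mult)
  also have "\<dots> = (\<Sum>i<2^k. \<Sum>j<2^k. \<Sum>l<2^n. \<Sum>x<2^n. \<Sum>y<2^n. K l $$ (i,x) * \<tau> $$ (x,y) * cnj (K l $$ (j,y))) / 2^k"
    by (simp add: sum_divide_distrib entry)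
  also have "(\<Sum>i<2^k. \<Sum>j<2^k. \<Sum>l<2^n. \<Sum>x<2^n. \<Sum>y<2^n. K l $$ (i,x) * \<tau> $$ (x,y) * cnj (K l $$ (j,y)))
     = (\<Sum>l<2^n. \<Sum>x<2^n. \<Sum>y<2^n. (\<Sum>i<2^k. K l $$ (i,x)) * \<tau> $$ (x,y) * cnj (\<Sum>j<2^k. K l $$ (j,y)))"
  proof -
    have sw: "(\<Sum>j<2^k. \<Sum>l<2^n. \<Sum>x<2^n. \<Sum>y<2^n. G j l x y) = (\<Sum>l<2^n. \<Sum>x<2^n. \<Sum>y<2^n. \<Sum>j<2^k. G j l x y)"
      for G :: "nat \<Rightarrow> nat \<Rightarrow> nat \<Rightarrow> nat \<Rightarrow> complex"
    proof -
      have "(\<Sum>j<2^k. \<Sum>l<2^n. \<Sum>x<2^n. \<Sum>y<2^n. G j l x y) = (\<Sum>l<2^n. \<Sum>j<2^k. \<Sum>x<2^n. \<Sum>y<2^n. G j l x y)"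
        by (rule sum.swap)
      also have "\<dots> = (\<Sum>l<2^n. \<Sum>x<2^n. \<Sum>j<2^k. \<Sum>y<2^n. G j l x y)"
        by (intro sum.cong refl sum.swap)
      also have "\<dots> = (\<Sum>l<2^n. \<Sum>x<2^n. \<Sum>y<2^n. \<Sum>j<2^k. G j l x y)"
        by (intro sum.cong refl sum.swap)
      finally show ?thesis .
    qed
    show ?thesis unfolding sw
      by (simp add: sum_distrib_left sum_distrib_right)
        (rule sum.cong[OF refl], rule sum.cong[OF refl], rule sum.cong[OF refl], rule sum.swap)
  qed
  also have "\<dots> = (\<Sum>l<2^n. complex_of_real (error_prob a n (D l)))"
  proof (rule sum.cong[OF refl])
    fix l assume l: "l \<in> {..<(2::nat)^n}"
    have "(\<Sum>x<2^n. \<Sum>y<2^n. (\<Sum>i<2^k. K l $$ (i,x)) * \<tau> $$ (x,y) * cnj (\<Sum>j<2^k. K l $$ (j,y)))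
      = (\<Sum>x<2^n. \<Sum>y<2^n. complex_of_real (character n (D l) x) * \<tau> $$ (x,y) * complex_of_real (character n (D l) y) / 2^n)"
    proof (intro sum.cong refl)
      fix x y :: nat assume xy: "x \<in> {..<2^n}" "y \<in> {..<2^n}"
      have s: "complex_of_real (sqrt (2^n)) * complex_of_real (sqrt (2^n)) = 2^n"
        by (simp flip: of_real_mult)
      show "(\<Sum>i<2^k. K l $$ (i,x)) * \<tau> $$ (x,y) * cnj (\<Sum>j<2^k. K l $$ (j,y))
        = complex_of_real (character n (D l) x) * \<tau> $$ (x,y) * complex_of_real (character n (D l) y) / 2^n"
        using xy by (simp add: colsum s[symmetric] del: cnj_sum)
    qed
    also have "\<dots> = complex_of_real (2 ^ n * error_prob a n (D l)) / 2^n"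
      using character_expectation[OF D, of l a] l by (simp add: \<tau>_def flip: sum_divide_distrib)
    finally show "(\<Sum>x<2^n. \<Sum>y<2^n. (\<Sum>i<2^k. K l $$ (i,x)) * \<tau> $$ (x,y) * cnj (\<Sum>j<2^k. K l $$ (j,y)))
      = complex_of_real (error_prob a n (D l))" by simp
  qed
  finally have "conjugate v \<bullet> (\<omega> *\<^sub>v v) = complex_of_real ((\<Sum>l<2^n. error_prob a n (D l)) / 2^k)"
    by simp
  then have "Re (conjugate v \<bullet> (\<omega> *\<^sub>v v)) = (\<Sum>l<2^n. error_prob a n (D l)) / 2^k"
    by (simp only: Re_complex_of_real)
  then show ?thesis
    using fidelity_pure[OF \<omega> v] unfolding Phi \<omega>_def \<tau>_def by simp
qed

text \<open>\<open>s\<close> is the success probability of the decoder and its root the fidelity.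
  The weight \<open>B w\<close> given to the code construction measures how hard it is to tell an
  error from its translate by \<open>w\<close>, so that the cheapest code is also the one with the
  smallest union bound. The upper bound on \<open>s\<close> closes the later squeeze.\<close>

lemma distill_dephased:
  assumes a: "0 \<le> a" "a \<le> 1/2" and kn: "k \<le> n"
  defines "c \<equiv> (sqrt (1/2 + a) + sqrt (1/2 - a))\<^sup>2"
  shows "\<exists>Ks s. incoherent_op (2^n) (2^k) Ks \<and>
     fidelity (apply_op (2^k) Ks (tpow n (dephased a))) (tpow k Phi2) = complex_of_real (sqrt s) \<and>
     1 - 2 * 2^k * c^n / 2^n \<le> s \<and> s \<le> 1"
proof -
  let ?p = "error_prob a n"
  have p0: "0 \<le> ?p e" for e by (rule error_prob_nonneg[OF a])
  define B where "B w = (\<Sum>x<2^n. sqrt (?p x * ?p (xor x w)))" for w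
  have B0: "0 \<le> B w" for w unfolding B_def by (intro sum_nonneg) (simp add: p0)
  obtain W f where W: "W \<subseteq> {..<2^n}" "0 \<in> W" "\<forall>v\<in>W. \<forall>w\<in>W. xor v w \<in> W" "card W = 2 ^ k"
    and f: "\<forall>x. f x < (2 ^ k :: nat)" and fW: "\<forall>x y. f x = f y \<longrightarrow> (\<forall>w\<in>W. character n w (xor x y) = 1)"
    and cost: "2 ^ n * (\<Sum>w\<in>W - {0}. B w) \<le> 2 * (2 ^ k - 1) * (\<Sum>x<2^n. B x)"
    using good_code_exists[of B k n, OF B0 kn] by (elim exE conjE) (rule that, assumption+)
  have "(\<Sum>w<2^n. B w) = (\<Sum>x<2^n. \<Sum>w<2^n. sqrt (?p x) * sqrt (?p (xor w x)))"
    unfolding B_def by (subst sum.swap) (simp add: real_sqrt_mult xor.commute)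
  also have "\<dots> = (\<Sum>x<2^n. sqrt (?p x) * (\<Sum>w<2^n. sqrt (?p w)))"
    by (intro sum.cong refl) (use sum_xor_reindex[of _ n "\<lambda>w. sqrt (?p w)"] in \<open>simp flip: sum_distrib_left\<close>)
  also have "\<dots> = c ^ n"
    unfolding sum_distrib_right[symmetric] sum_sqrt_error_prob c_def
    by (simp add: power2_eq_square power_mult_distrib)
  finally have sumB: "(\<Sum>w<2^n. B w) = c ^ n" .
  have c0: "0 \<le> c" by (simp add: c_def)
  have "2 * (2 ^ k - 1) * c ^ n \<le> 2 * 2 ^ k * c ^ n"
    using c0 by (intro mult_right_mono) auto
  then have fail: "(\<Sum>w\<in>W - {0}. B w) \<le> 2 * 2^k * c^n / 2^n"
    using cost unfolding sumB by (simp add: pos_le_divide_eq mult.commute)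
  obtain D where D: "\<And>l. l < 2 ^ n \<Longrightarrow> D l < 2 ^ n" "\<And>l. xor l (D l) \<in> W"
    "(\<Sum>l<2^n. ?p (D l)) \<le> real (card W)"
    "real (card W) * (1 - (\<Sum>w\<in>W - {0}. \<Sum>x<2^n. sqrt (?p x * ?p (xor x w)))) \<le> (\<Sum>l<2^n. ?p (D l))"
    using coset_decoder_exists[of ?p n W, OF p0 sum_error_prob W(1,2)] W(3) by blast
  define s where "s = (\<Sum>l<2^n. ?p (D l)) / 2^k"
  have "s \<le> 1" using D(3) unfolding s_def W(4) by simp
  moreover have "1 - (\<Sum>w\<in>W - {0}. B w) \<le> s"
    using D(4) unfolding s_def W(4) B_def by (simp add: pos_le_divide_eq mult.commute)
  moreover have "incoherent_op (2^n) (2^k) (code_op n k f D)"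
    by (rule code_op_incoherent[where W=W]) (use f fW D in blast)+
  moreover have "fidelity (apply_op (2^k) (code_op n k f D) (tpow n (dephased a))) (tpow k Phi2) = complex_of_real (sqrt s)"
    unfolding s_def by (rule code_op_fidelity) (use f D a in auto)
  ultimately show ?thesis using fail by (intro exI[of _ "code_op n k f D"] exI[of _ s]) auto
qed

lemma positive_rate_exists:
  fixes c :: real
  assumes c: "1 \<le> c" "c < 2"
  shows "\<exists>R>0. R \<le> 1 \<and> (\<lambda>n. 2 * 2 ^ nat \<lfloor>real n * R\<rfloor> * c ^ n / 2 ^ n) \<longlonglongrightarrow> 0"
proof -
  \<comment> \<open>Any rate below \<open>log 2 (2 / c)\<close> would make the error vanish; half of
    it leaves the decay factor \<open>sqrt (c / 2)\<close>. Since \<open>c \<ge> 1\<close>, the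
    logarithm is at most 1, so that \<open>R \<le> 1\<close> and a code with
    \<open>k \<le> n\<close> can exist.\<close>
  define R where "R = log 2 (2 / c) / 2"
  have "0 < log 2 (2 / c)" using c by (simp add: zero_less_log_cancel_iff)
  moreover have "log 2 (2 / c) \<le> 1" using c by (simp add: log_le_one_cancel_iff divide_le_eq)
  ultimately have R: "0 < R" "R \<le> 1" by (auto simp: R_def)
  have "2 powr R = sqrt (2 / c)"
  proof -
    have "2 powr R = (2 powr log 2 (2 / c)) powr (1/2)" by (simp add: R_def powr_powr)
    then show ?thesis using c by (simp add: powr_half_sqrt)
  qed
  define q where "q = sqrt (2 / c) * (c / 2)"
  have "q = sqrt (c / 2)"
  proof -
    have "sqrt (c / 2) * sqrt (c / 2) = c / 2" using c by (subst real_sqrt_mult_self) simp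
    then have "q = sqrt (2 / c) * (sqrt (c / 2) * sqrt (c / 2))" by (simp only: q_def)
    also have "\<dots> = (sqrt (2 / c) * sqrt (c / 2)) * sqrt (c / 2)" by (rule mult.assoc[symmetric])
    also have "sqrt (2 / c) * sqrt (c / 2) = sqrt (2 / c * (c / 2))"
      by (rule real_sqrt_mult[symmetric])
    also have "2 / c * (c / 2) = 1" using c by simp
    finally show ?thesis by simp
  qed
  then have q: "0 \<le> q" "q < 1" using c by auto
  have bound: "2 * 2 ^ nat \<lfloor>real n * R\<rfloor> * c ^ n / 2 ^ n \<le> 2 * q ^ n" for n
  proof -
    have "(2::real) ^ nat \<lfloor>real n * R\<rfloor> = 2 powr real (nat \<lfloor>real n * R\<rfloor>)" by (simp add: powr_realpow)
    also have "\<dots> \<le> 2 powr (R * real n)"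
      using R(1) by (intro powr_mono) (auto simp: mult.commute of_nat_floor)
    also have "\<dots> = sqrt (2 / c) ^ n"
      using \<open>2 powr R = sqrt (2 / c)\<close> c by (simp add: powr_powr[symmetric] powr_realpow)
    finally have "2 * 2 ^ nat \<lfloor>real n * R\<rfloor> * (c ^ n / 2 ^ n) \<le> 2 * sqrt (2 / c) ^ n * (c ^ n / 2 ^ n)"
      using c by (intro mult_right_mono mult_left_mono) auto
    also have "\<dots> = 2 * q ^ n" by (simp add: q_def power_mult_distrib power_divide)
    finally show ?thesis by simp
  qed
  have "(\<lambda>n. 2 * q ^ n) \<longlonglongrightarrow> 0"
    using LIMSEQ_realpow_zero[OF q] tendsto_mult_right_zero by blast
  then have "(\<lambda>n. 2 * 2 ^ nat \<lfloor>real n * R\<rfloor> * c ^ n / 2 ^ n) \<longlonglongrightarrow> 0"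
    by (rule tendsto_sandwich[OF _ _ tendsto_const, rotated 2]) (use bound c in \<open>auto intro!: always_eventually\<close>)
  then show ?thesis using R by blast
qed

lemma distill_achievable_coherent:
  assumes st: "is_state d \<rho>" and pq: "p < d" "q < d" "p \<noteq> q" and nz: "\<rho> $$ (p,q) \<noteq> 0"
  shows "\<exists>R>0. distill_achievable d \<rho> R"
proof -
  have rc: "\<rho> \<in> carrier_mat d d" using st psdD(1) by (auto simp: is_state_def)
  define a where "a = cmod (\<rho> $$ (p,q))"
  have a: "0 < a" "a \<le> 1/2" using nz off_diagonal_le[OF st pq] by (auto simp: a_def)
  obtain Ks where Ks: "incoherent_op d 2 Ks" "apply_op 2 Ks \<rho> = dephased a"
    using dephased_from_coherent[OF st pq nz] unfolding a_def by blast
  define c where "c = (sqrt (1/2 + a) + sqrt (1/2 - a))\<^sup>2"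
  have c_eq: "c = 1 + 2 * (sqrt (1/2 + a) * sqrt (1/2 - a))"
    using a unfolding c_def power2_sum by simp
  \<comment> \<open>The strict inequality \<open>c < 2\<close> is where a nonzero off-diagonal entry
    is used: for \<open>a = 0\<close> this product would be exactly 1/2.\<close>
  have "sqrt (1/2 + a) * sqrt (1/2 - a) = sqrt (1/4 - a\<^sup>2)"
    by (simp add: power2_eq_square algebra_simps flip: real_sqrt_mult)
  also have "\<dots> < sqrt (1/4)" using a by (simp only: real_sqrt_less_iff) simp
  also have "sqrt (1/4) = (1/2::real)" by (simp add: real_sqrt_divide)
  finally have c: "1 \<le> c" "c < 2" unfolding c_eq using a by auto
  obtain R where R: "0 < R" "R \<le> 1" and lim: "(\<lambda>n. 2 * 2 ^ nat \<lfloor>real n * R\<rfloor> * c ^ n / 2 ^ n) \<longlonglongrightarrow> 0"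
    using positive_rate_exists[OF c] by blast
  define k where "k n = nat \<lfloor>real n * R\<rfloor>" for n
  have kn: "k n \<le> n" for n
  proof -
    have "real n * R \<le> real n" using R by (simp add: mult_left_le)
    then show ?thesis unfolding k_def by linarith
  qed
  have "\<exists>Ls s. incoherent_op (2^n) (2^k n) Ls \<and>
     fidelity (apply_op (2^k n) Ls (tpow n (dephased a))) (tpow (k n) Phi2) = complex_of_real (sqrt s) \<and>
     1 - 2 * 2^k n * c^n / 2^n \<le> s \<and> s \<le> 1" for n
    unfolding c_def by (rule distill_dephased) (use a kn in auto)
  then obtain L s where L: "\<And>n. incoherent_op (2^n) (2^k n) (L n)"
    and F: "\<And>n. fidelity (apply_op (2^k n) (L n) (tpow n (dephased a))) (tpow (k n) Phi2) = complex_of_real (sqrt (s n))"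
    and s: "\<And>n. 1 - 2 * 2^k n * c^n / 2^n \<le> s n" "\<And>n. s n \<le> 1"
    by metis
  have "(\<lambda>n. 1 - 2 * 2^k n * c^n / 2^n) \<longlonglongrightarrow> 1 - 0"
    unfolding k_def by (intro tendsto_diff tendsto_const lim)
  then have "s \<longlonglongrightarrow> 1"
    by (intro tendsto_sandwich[of "\<lambda>n. 1 - 2 * 2^k n * c^n / 2^n" s sequentially "\<lambda>_. 1"])
       (auto simp: s)
  then have Flim: "(\<lambda>n. complex_of_real (sqrt (s n))) \<longlonglongrightarrow> 1"
    using tendsto_of_real[OF tendsto_real_sqrt[of s 1]] by simp
  \<comment> \<open>Each copy is converted separately, so what reaches the code operation is exactly
    the n-fold dephased qubit, and the fidelity carries over without loss.\<close>
  define T where "T n = op_comp (L n) (op_pow n Ks)" for n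
  have T: "incoherent_op (d ^ n) (2 ^ k n) (T n)" for n
    unfolding T_def by (rule incoherent_op_comp[OF L incoherent_op_pow[OF Ks(1)]])
  have "apply_op (2 ^ k n) (T n) (tpow n \<rho>) = apply_op (2 ^ k n) (L n) (tpow n (dephased a))" for n
    unfolding T_def Ks(2)[symmetric] apply_op_pow[OF Ks(1) rc, symmetric]
    by (rule apply_op_comp[where m="d ^ n"])
       (use L incoherent_op_pow[OF Ks(1)] tpow_carrier[OF rc] in \<open>auto intro: incoherent_op_carrier\<close>)
  then have "(\<lambda>n. fidelity (apply_op (2 ^ k n) (T n) (tpow n \<rho>)) (tpow (k n) Phi2)) \<longlonglongrightarrow> 1"
    using Flim by (simp add: F)
  then have "distill_achievable d \<rho> R"
    unfolding distill_achievable_def using R(1) T by (auto simp: k_def)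
  then show ?thesis using R(1) by blast
qed

theorem theorem7:
  fixes d :: nat and \<rho> :: "complex mat"
  assumes "is_state d \<rho>"
    and "distillable_coherence d \<rho> = 0"
  shows "coherence_cost d \<rho> = 0"
proof -
  have "\<rho> $$ (i,j) = 0" if ij: "i < d" "j < d" "i \<noteq> j" for i j
  proof (rule ccontr)
    assume "\<rho> $$ (i,j) \<noteq> 0"
    then obtain R where "0 < R" "distill_achievable d \<rho> R"
      using distill_achievable_coherent[OF assms(1) ij] by blast
    then have "ereal R \<le> distillable_coherence d \<rho>"
      unfolding distillable_coherence_def by (intro Sup_upper) auto
    then show False using assms(2) \<open>0 < R\<close> by simp
  qed
  then have "cost_achievable d \<rho> 0"
    by (rule cost_achievable_diagonal[OF assms(1)])
  then have "coherence_cost d \<rho> \<le> ereal 0"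
    unfolding coherence_cost_def by (intro Inf_lower) auto
  moreover have "0 \<le> coherence_cost d \<rho>"
    unfolding coherence_cost_def by (intro Inf_greatest) (auto simp: cost_achievable_def)
  ultimately show ?thesis by (simp add: zero_ereal_def)
qed

end
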